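(* Let $R$ be a Galois ring of odd characteristic which is not a field, and let $K\le R^\times$. Then the cyclotomic scheme $\mathrm{Cyc}(K,R)$ is normal if and only if $K$ is pure.
   Context: All rings have an identity. A finite local commutative ring $R$ with unique maximal ideal $\mathrm{rad}(R)$ and residue field of characteristic $p$ is a Galois ring if $\mathrm{rad}(R)=pR$. For a subgroup $K$ of $R^\times$, the cyclotomic scheme $\mathrm{Cyc}(K,R)$ is the pair $(R,\mathrm{Rel}(K,R))$, where $\mathrm{Rel}(K,R)$ is the set of binary relations $\{(x,y)\in R\times R:\ y-x\in rK\}$, $r\in R$. Its automorphism group $\mathrm{Aut}(\mathcal C)$ is the group of permutations $f$ of $R$ with $S^f=S$ for every $S\in\mathrm{Rel}(K,R)$. $\mathrm{A\Gamma L}_1(R)$ is the group of permutations $x\mapsto ax^\sigma+b$ with $a\in R^\times$, $b\in R$, $\sigma\in\mathrm{Aut}(R)$; the scheme is normal if $\mathrm{Aut}(\mathcal C)\le\mathrm{A\Gamma L}_1(R)$. A group $K\le R^\times$ is pure if the only ideal $I$ of $R$ with $K+I=K$ (equivalently $1+I\subseteq K$) is $I=\{0\}$. *)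

theory Defs
  imports "HOL-Computational_Algebra.Primes"
begin

definition is_ideal :: "'a::comm_ring_1 set \<Rightarrow> bool" where
  "is_ideal I \<longleftrightarrow> 0 \<in> I \<and> (\<forall>x\<in>I. \<forall>y\<in>I. x + y \<in> I) \<and> (\<forall>r. \<forall>x\<in>I. r * x \<in> I)"

definition maximal_ideal :: "'a::comm_ring_1 set \<Rightarrow> bool" where
  "maximal_ideal M \<longleftrightarrow> is_ideal M \<and> M \<noteq> UNIV \<and>
     (\<forall>J. is_ideal J \<and> M \<subseteq> J \<longrightarrow> J = M \<or> J = UNIV)"

definition local_ring :: "'a::comm_ring_1 itself \<Rightarrow> bool" where
  "local_ring _ \<longleftrightarrow> (\<exists>!M::'a set. maximal_ideal M)"

definition rad :: "'a::comm_ring_1 itself \<Rightarrow> 'a set" where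
  "rad _ = (THE M::'a set. maximal_ideal M)"

text \<open>Finite local commutative ring whose residue field has characteristic p,
  with rad(R) = pR.\<close>
definition galois_ring :: "'a::{comm_ring_1,finite} itself \<Rightarrow> bool" where
  "galois_ring T \<longleftrightarrow> local_ring T \<and>
     (\<exists>p::nat. prime p \<and> (of_nat p :: 'a) \<in> rad T \<and>
        rad T = {of_nat p * r | r::'a. True})"

definition is_field_ring :: "'a::comm_ring_1 itself \<Rightarrow> bool" where
  "is_field_ring _ \<longleftrightarrow> (0::'a) \<noteq> 1 \<and> (\<forall>x::'a. x \<noteq> 0 \<longrightarrow> x dvd 1)"

definition units_set :: "'a::comm_ring_1 set" where
  "units_set = {x. x dvd 1}"

definition unit_subgroup :: "'a::comm_ring_1 set \<Rightarrow> bool" where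
  "unit_subgroup K \<longleftrightarrow> K \<subseteq> units_set \<and> 1 \<in> K \<and>
     (\<forall>x\<in>K. \<forall>y\<in>K. x * y \<in> K) \<and> (\<forall>x\<in>K. \<exists>y\<in>K. x * y = 1)"

definition cyc_rel :: "'a::comm_ring_1 set \<Rightarrow> ('a \<times> 'a) set set" where
  "cyc_rel K = {{(x, y). y - x \<in> (\<lambda>k. r * k) ` K} | r. True}"

definition cyc_aut :: "'a::comm_ring_1 set \<Rightarrow> ('a \<Rightarrow> 'a) set" where
  "cyc_aut K = {f. bij f \<and> (\<forall>S\<in>cyc_rel K. (\<lambda>(x, y). (f x, f y)) ` S = S)}"

definition ring_aut :: "('a::comm_ring_1 \<Rightarrow> 'a) \<Rightarrow> bool" where
  "ring_aut \<sigma> \<longleftrightarrow> bij \<sigma> \<and> \<sigma> 1 = 1 \<and> (\<forall>x y. \<sigma> (x + y) = \<sigma> x + \<sigma> y) \<and>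
     (\<forall>x y. \<sigma> (x * y) = \<sigma> x * \<sigma> y)"

definition AGammaL1 :: "('a::comm_ring_1 \<Rightarrow> 'a) set" where
  "AGammaL1 = {f. \<exists>a b \<sigma>. a dvd 1 \<and> ring_aut \<sigma> \<and> f = (\<lambda>x. a * \<sigma> x + b)}"

definition cyc_normal :: "'a::comm_ring_1 set \<Rightarrow> bool" where
  "cyc_normal K \<longleftrightarrow> cyc_aut K \<subseteq> AGammaL1"

definition pure :: "'a::comm_ring_1 set \<Rightarrow> bool" where
  "pure K \<longleftrightarrow> (\<forall>I. is_ideal I \<and> {k + i | k i. k \<in> K \<and> i \<in> I} = K \<longrightarrow> I = {0})"

end

(* Write F for the residue field R / pR and n for the nilpotency index of p.

   If K + I = K with a nonzero a in I, adding a on pR and fixing everything else preserves every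
   relation of the scheme, and it is not affine because 2 is invertible.

   Conversely let K be pure and let f be an automorphism of the scheme with f 0 = 0 and f 1 = 1, so
   that f y - f x lies in (y - x) K. For 1 <= m < n the classes v with 1 + p^m v in K + p^(m+1) R form
   an additive subgroup of F, which is proper: raising to p-th powers would otherwise push
   1 + p^(n-1) R into K. Properness for m = 1 forces each map 1 / (y - x) |-> 1 / (f y - f x) on F to
   be additive, and an argument in the style of Hua's theorem shows that f modulo p is a field
   automorphism. If f is a ring homomorphism modulo p^m, its defects of additivity and
   multiplicativity modulo p^(m+1) are F-valued; their quotients by f s lie in a proper additive
   subgroup, and an additive g on F with all g s / s in a proper additive subgroup is linear, which
   makes the defects vanish. *)
theory Submission
  imports Defs "HOL-Computational_Algebra.Polynomial" "HOL-Number_Theory.Cong"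
begin

section \<open>Additive maps on finite fields\<close>

text \<open>Every digit estimate has one source: if a difference of values of f is w k, and a
  reference unit is w j with j, k in K, then k / j lies in K; once k / j is 1 modulo p^m, its next
  digit lies in \<open>layer m\<close>. Only membership in a subgroup is ever known about a digit,
  so properness has to do all the work, in two ways: a F inside a proper subgroup forces a = 0, and
  an additive map with quotients in a proper subgroup is linear. The second way needs additivity,
  whereas the additive defect of f modulo p^(m+1) is at first only a symmetric cocycle. The way
  around this is to weaken the property that is carried along: second differences of f satisfy the
  divisibility and layer conditions, and these survive further differencing. Difference operators
  are nilpotent modulo p^(m+1) on functions with values in p^m R, so there is a last iterated
  difference that is not affine; its second difference no longer depends on the base point, hence is
  a symmetric biadditive form. Odd p is used for the p-th power step, for a degree bound in the
  linearity lemma, and for division by 2.\<close>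

definition add_closed :: "'a::comm_ring_1 set \<Rightarrow> bool" where
  "add_closed A \<longleftrightarrow> 0 \<in> A \<and> (\<forall>x\<in>A. \<forall>y\<in>A. x + y \<in> A)"

lemma add_closed_of_nat_mult:
  assumes "add_closed A" "x \<in> A"
  shows "of_nat k * x \<in> A"
  using assms by (induction k) (auto simp: add_closed_def algebra_simps)

text \<open>In characteristic p the negative of x is the (p - 1)-fold sum of x, so closure under
  addition already gives a subgroup.\<close>

lemma add_closed_uminus:
  fixes A :: "'a::finite_field set"
  assumes "add_closed A" "x \<in> A"
  shows "- x \<in> A"
proof -
  have "of_nat (CHAR('a) - 1) * x \<in> A"
    using add_closed_of_nat_mult[OF assms] .
  moreover have "(of_nat (CHAR('a) - 1) :: 'a) = - 1"
    by (subst of_nat_diff) (use CHAR_pos[where 'a='a] in \<open>simp_all add: Suc_leI\<close>)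
  ultimately show ?thesis by simp
qed

lemma add_closed_diff:
  fixes A :: "'a::finite_field set"
  assumes "add_closed A" "x \<in> A" "y \<in> A"
  shows "x - y \<in> A"
  using assms add_closed_uminus[OF assms(1,3)] unfolding add_closed_def
  by (metis add_uminus_conv_diff)

section \<open>Linearized polynomials and the additive subgroups on which they vanish\<close>

definition linearized :: "nat \<Rightarrow> ('a::finite_field \<Rightarrow> 'a) \<Rightarrow> bool" where
  "linearized e P \<longleftrightarrow> (\<exists>c. \<forall>s. P s = (\<Sum>i<e. c i * s ^ (CHAR('a) ^ i)))"

lemma linearized_zero: "linearized e (\<lambda>s. 0)"
  unfolding linearized_def by (rule exI[of _ "\<lambda>_. 0"]) simp

lemma linearized_add:
  assumes "linearized e P" "linearized e Q"
  shows "linearized e (\<lambda>s. P s + Q s)"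
proof -
  obtain c d where "\<And>s. P s = (\<Sum>i<e. c i * s ^ (CHAR('a) ^ i))"
    "\<And>s. Q s = (\<Sum>i<e. d i * s ^ (CHAR('a) ^ i))"
    using assms unfolding linearized_def by blast
  then show ?thesis unfolding linearized_def
    by (intro exI[of _ "\<lambda>i. c i + d i"]) (simp add: distrib_right sum.distrib)
qed

lemma linearized_cmult:
  assumes "linearized e P"
  shows "linearized e (\<lambda>s. u * P s)"
proof -
  obtain c where "\<And>s. P s = (\<Sum>i<e. c i * s ^ (CHAR('a) ^ i))"
    using assms unfolding linearized_def by blast
  then show ?thesis unfolding linearized_def
    by (intro exI[of _ "\<lambda>i. u * c i"]) (simp add: sum_distrib_left mult.assoc)
qed

lemma linearized_Suc:
  assumes "linearized e P"
  shows "linearized (Suc e) P"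
proof -
  obtain c where "\<And>s. P s = (\<Sum>i<e. c i * s ^ (CHAR('a) ^ i))"
    using assms unfolding linearized_def by blast
  then show ?thesis unfolding linearized_def
    by (intro exI[of _ "c(e := 0)"]) simp
qed

lemma linearized_power:
  assumes "linearized e (P :: 'a::finite_field \<Rightarrow> 'a)"
  shows "linearized (Suc e) (\<lambda>s. P s ^ CHAR('a))"
proof -
  obtain c where c: "\<And>s. P s = (\<Sum>i<e. c i * s ^ (CHAR('a) ^ i))"
    using assms unfolding linearized_def by blast
  define d where "d i = (case i of 0 \<Rightarrow> 0 | Suc j \<Rightarrow> c j ^ CHAR('a))" for i
  have "P s ^ CHAR('a) = (\<Sum>i<Suc e. d i * s ^ (CHAR('a) ^ i))" for s
    unfolding c freshmans_dream_sum[OF CHAR_prime refl] sum.lessThan_Suc_shift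
    by (simp add: d_def power_mult_distrib mult.commute flip: power_mult)
  then show ?thesis unfolding linearized_def by blast
qed

lemma linearized_monom: "linearized (Suc e) (\<lambda>s. s ^ (CHAR('a::finite_field) ^ e) :: 'a)"
  unfolding linearized_def
  by (rule exI[of _ "\<lambda>i. if i = e then 1 else 0"]) simp

lemma linearized_additive:
  fixes P :: "'a::finite_field \<Rightarrow> 'a"
  assumes "linearized e P"
  shows "P (x + y) = P x + P y"
proof -
  obtain c where "\<And>s. P s = (\<Sum>i<e. c i * s ^ (CHAR('a) ^ i))"
    using assms unfolding linearized_def by blast
  then show ?thesis
    by (simp add: freshmans_dream'[OF CHAR_prime refl] distrib_left sum.distrib)
qed

lemma additive_of_nat:
  fixes g :: "'a::comm_ring_1 \<Rightarrow> 'b::comm_ring_1"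
  assumes "\<And>x y. g (x + y) = g x + g y"
  shows "g (of_nat k * x) = of_nat k * g x"
proof -
  have "g 0 = 0" using assms[of 0 0] by simp
  then show ?thesis by (induction k) (simp_all add: algebra_simps assms)
qed

lemma of_nat_power_CHAR: "(of_nat k :: 'a::finite_field) ^ CHAR('a) = of_nat k"
proof (induction k)
  case 0 then show ?case by (simp add: power_0_left)
next
  case (Suc k)
  then show ?case using freshmans_dream[OF CHAR_prime refl, of 1 "of_nat k :: 'a"] by simp
qed

text \<open>The polynomial is monic of degree p^e, hence nonzero with at most p^e roots. This later
  identifies a subgroup with the whole zero set of its vanishing polynomial.\<close>

lemma card_zeros_monic_linearized:
  fixes Q :: "'a::finite_field \<Rightarrow> 'a"
  assumes "linearized e Q"
  shows "card {s. s ^ (CHAR('a) ^ e) + Q s = 0} \<le> CHAR('a) ^ e"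
proof -
  obtain c where c: "\<And>s. Q s = (\<Sum>i<e. c i * s ^ (CHAR('a) ^ i))"
    using assms unfolding linearized_def by blast
  define f where "f = monom 1 (CHAR('a) ^ e) + (\<Sum>i<e. monom (c i) (CHAR('a) ^ i))"
  have gt1: "CHAR('a) > 1" using CHAR_prime[where 'a='a] prime_gt_1_nat by blast
  have "coeff f (CHAR('a) ^ e) = 1"
    unfolding f_def coeff_add coeff_sum coeff_monom using gt1 by simp
  then have "f \<noteq> 0" by auto
  have "degree f \<le> CHAR('a) ^ e"
    unfolding f_def
    by (intro degree_add_le degree_sum_le)
      (use gt1 in \<open>auto intro!: order.trans[OF degree_monom_le] simp: power_increasing_iff\<close>)
  moreover have "{s. s ^ (CHAR('a) ^ e) + Q s = 0} = {s. poly f s = 0}"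
    unfolding f_def c by (simp add: poly_monom poly_sum)
  ultimately show ?thesis
    using card_poly_roots_bound[OF \<open>f \<noteq> 0\<close>] by simp
qed

text \<open>A subgroup is enlarged by one generator at a time, and its order, its monic vanishing
  polynomial and interpolation of additive maps on it are carried along together. A largest subgroup
  of A for which all three are available must be A.\<close>

lemma additive_flag:
  fixes A :: "'a::finite_field set"
  assumes A: "add_closed A"
  obtains e Q where "card A = CHAR('a) ^ e" "linearized e Q"
    "\<And>s. s \<in> A \<Longrightarrow> s ^ (CHAR('a) ^ e) + Q s = 0"
    "\<And>g. (\<And>x y. g (x + y) = g x + g y) \<Longrightarrow> \<exists>P. linearized e P \<and> (\<forall>s\<in>A. g s = P s)"
proof -
  let ?p = "CHAR('a)"
  have gt1: "?p > 1" using CHAR_prime[where 'a='a] prime_gt_1_nat by blast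
  define good where "good B \<longleftrightarrow> (\<exists>e Q. card B = ?p ^ e \<and> linearized e Q \<and>
      (\<forall>s\<in>B. s ^ (?p ^ e) + Q s = 0) \<and>
      (\<forall>g. (\<forall>x y. g (x + y) = g x + g y) \<longrightarrow> (\<exists>P. linearized e P \<and> (\<forall>s\<in>B. g s = P s))))"
    for B :: "'a set"
  have "good {0}"
    unfolding good_def
  proof (rule exI[of _ 0], rule exI[of _ "\<lambda>_. 0"], intro conjI allI impI)
    fix g :: "'a \<Rightarrow> 'a" assume "\<forall>x y. g (x + y) = g x + g y"
    then have "g 0 = g 0 + g 0" by (metis add.right_neutral)
    then have "g 0 = 0" by (metis add_cancel_right_right)
    then show "\<exists>P. linearized 0 P \<and> (\<forall>s\<in>{0}. g s = P s)"
      using linearized_zero by (intro exI[of _ "\<lambda>_. 0"]) auto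
  qed (auto simp: linearized_zero)
  then have "\<exists>B. B \<subseteq> A \<and> add_closed B \<and> good B \<and>
     (\<forall>B'. B' \<subseteq> A \<and> add_closed B' \<and> good B' \<longrightarrow> card B' \<le> card B)"
    using A
    by (intro ex_has_greatest_nat[of "\<lambda>B. B \<subseteq> A \<and> add_closed B \<and> good B" "{0}" card "Suc (card A)",
          simplified conj_assoc])
      (auto simp: add_closed_def card_mono less_Suc_eq_le)
  then obtain B where B: "B \<subseteq> A" "add_closed B" "good B"
    and maxB: "\<And>B'. B' \<subseteq> A \<Longrightarrow> add_closed B' \<Longrightarrow> good B' \<Longrightarrow> card B' \<le> card B"
    by blast
  obtain e Q where e: "card B = ?p ^ e" "linearized e Q"
    and Q: "\<And>s. s \<in> B \<Longrightarrow> s ^ (?p ^ e) + Q s = 0"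
    and interp: "\<And>g. (\<forall>x y. g (x + y) = g x + g y) \<Longrightarrow> \<exists>P. linearized e P \<and> (\<forall>s\<in>B. g s = P s)"
    using B(3) unfolding good_def by blast
  have "B = A"
  proof (rule ccontr)
    assume "B \<noteq> A"
    then obtain x where x: "x \<in> A" "x \<notin> B" using B(1) by blast
    define PB where "PB s = s ^ (?p ^ e) + Q s" for s
    have PBadd: "PB (s + t) = PB s + PB t" for s t
      unfolding PB_def linearized_additive[OF e(2)] freshmans_dream'[OF CHAR_prime refl]
      by (simp add: algebra_simps)
    \<comment> \<open>B consists of zeros and already has as many elements as the root bound allows,
      so \<open>PB\<close> cannot vanish at the new generator x.\<close>
    have "{s. PB s = 0} = B"
      using card_zeros_monic_linearized[OF e(2)] Q unfolding e(1)[symmetric] PB_def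
      by (intro card_seteq[symmetric]) auto
    then have PBx: "PB x \<noteq> 0" using x by blast
    define B' where "B' = (\<lambda>(k, y). of_nat k * x + y) ` ({..<?p} \<times> B)"
    have B'I: "of_nat k * x + y \<in> B'" if "y \<in> B" for k y
    proof -
      have "of_nat k * x = of_nat (k mod ?p) * x"
        by (simp add: of_nat_eq_iff_cong_CHAR cong_def)
      then show ?thesis using that gt1 unfolding B'_def
        by (intro image_eqI[of _ _ "(k mod ?p, y)"]) auto
    qed
    have closed: "add_closed B'"
      unfolding add_closed_def
    proof (intro conjI ballI)
      show "0 \<in> B'" using B'I[of 0 0] B(2) by (simp add: add_closed_def)
      fix a b assume "a \<in> B'" "b \<in> B'"
      then obtain k l y z where *: "a = of_nat k * x + y" "b = of_nat l * x + z" "y \<in> B" "z \<in> B"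
        unfolding B'_def by auto
      then have "a + b = of_nat (k + l) * x + (y + z)" by (simp add: algebra_simps)
      moreover have "y + z \<in> B" using * B(2) by (simp add: add_closed_def)
      ultimately show "a + b \<in> B'" using B'I[of "y + z" "k + l"] by metis
    qed
    have sub: "B' \<subseteq> A"
      unfolding B'_def using add_closed_of_nat_mult[OF A x(1)] A B(1) by (auto simp: add_closed_def)
    have "inj_on (\<lambda>(k, y). of_nat k * x + y) ({..<?p} \<times> B)"
    proof -
      have PBk: "PB (of_nat k * x + y) = of_nat k * PB x" if "y \<in> B" for k y
        using Q[OF that] PBadd additive_of_nat[of PB k x, OF PBadd] by (simp add: PB_def)
      show ?thesis
      proof (intro inj_onI; clarsimp)
        fix k y l z assume *: "k < ?p" "l < ?p" "y \<in> B" "z \<in> B" "of_nat k * x + y = of_nat l * x + z"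
        then have "(of_nat k :: 'a) * PB x = of_nat l * PB x"
          using PBk by metis
        then have "(of_nat k :: 'a) = of_nat l" using PBx by simp
        then have "k = l" using * by (simp add: of_nat_eq_iff_cong_CHAR cong_def)
        then show "k = l \<and> y = z" using * by simp
      qed
    qed
    then have cardB': "card B' = ?p ^ Suc e"
      unfolding B'_def by (subst card_image) (auto simp: card_cartesian_product e(1))
    have "good B'"
      unfolding good_def
    \<comment> \<open>The new vanishing polynomial is
      \<open>PB s ^ p - PB x ^ (p - 1) * PB s\<close>: on \<open>B'\<close> the values of
      \<open>PB\<close> are prime field multiples of \<open>PB x\<close>, and these are roots of T^p
      - \<open>PB x\<close>^(p-1) T.\<close>
    proof (rule exI[of _ "Suc e"], rule exI[of _ "\<lambda>s. Q s ^ ?p + (- (PB x ^ (?p - 1))) * PB s"], intro conjI ballI allI impI)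
      show "card B' = ?p ^ Suc e" by fact
      have linPB: "linearized (Suc e) PB"
        unfolding PB_def by (intro linearized_add linearized_monom linearized_Suc e)
      show "linearized (Suc e) (\<lambda>s. Q s ^ ?p + (- (PB x ^ (?p - 1))) * PB s)"
        by (intro linearized_add linearized_power linearized_cmult linPB e)
      fix s assume "s \<in> B'"
      then obtain k y where s: "s = of_nat k * x + y" "y \<in> B" unfolding B'_def by auto
      have PBs: "PB s = of_nat k * PB x"
        using Q[OF s(2)] PBadd additive_of_nat[of PB k x, OF PBadd] s by (simp add: PB_def)
      have "s ^ ?p ^ Suc e + Q s ^ ?p = PB s ^ ?p"
        unfolding PB_def freshmans_dream[OF CHAR_prime refl]
        by (simp add: mult.commute flip: power_mult)
      also have "\<dots> = PB x ^ (?p - 1) * PB s"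
        unfolding PBs power_mult_distrib of_nat_power_CHAR
        using gt1 by (simp add: mult_ac power_eq_if)
      finally show "s ^ ?p ^ Suc e + (Q s ^ ?p + (- (PB x ^ (?p - 1))) * PB s) = 0"
        by (simp add: algebra_simps)
    next
      have linPB: "linearized (Suc e) PB"
        unfolding PB_def by (intro linearized_add linearized_monom linearized_Suc e)
      fix g :: "'a \<Rightarrow> 'a" assume g: "\<forall>x y. g (x + y) = g x + g y"
      obtain P where P: "linearized e P" "\<forall>s\<in>B. g s = P s" using interp[OF g] by blast
      \<comment> \<open>Newton interpolation: a multiple of \<open>PB\<close> corrects the value at
        x and leaves the values on B alone.\<close>
      define P' where "P' s = P s + (g x - P x) / PB x * PB s" for s
      have lin': "linearized (Suc e) P'"
        unfolding P'_def by (intro linearized_add linearized_cmult linPB linearized_Suc P)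
      have "P' x = g x" unfolding P'_def using PBx by simp
      moreover have "P' y = g y" if "y \<in> B" for y
        unfolding P'_def using P(2) Q[OF that] that by (simp add: PB_def)
      ultimately have "g s = P' s" if "s \<in> B'" for s
        using that g additive_of_nat[of g _ x] additive_of_nat[of P' _ x, OF linearized_additive[OF lin']]
        unfolding B'_def by (auto simp: linearized_additive[OF lin'])
      then show "\<exists>P. linearized (Suc e) P \<and> (\<forall>s\<in>B'. g s = P s)" using lin' by blast
    qed
    then have "card B' \<le> card B" using maxB[OF sub closed] by blast
    then show False unfolding cardB' e(1) using gt1 by simp
  qed
  then show ?thesis using e Q interp that by metis
qed


text \<open>Rearranged, p^a - p^b = p^c - p^d. If one exponent lay strictly below both exponents of
  the other side, that side would be divisible by the next power of p; but the side with the small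
  exponent is either not divisible by it or is at most twice the smaller power, which is too small
  for p > 2.\<close>

lemma power_diff_inj:
  fixes p :: nat
  assumes p: "p > 2" and "a \<noteq> b" and eq: "p ^ a + p ^ d = p ^ c + p ^ b"
  shows "a = c \<and> b = d"
proof -
  have aux: False if "a < c" "a < b" "p ^ a + p ^ d = p ^ c + p ^ b" for a b c d :: nat
  proof -
    have dvd: "p ^ Suc a dvd p ^ c" "p ^ Suc a dvd p ^ b"
      using that by (auto intro!: le_imp_power_dvd simp del: power_Suc)
    have "d \<le> a"
    proof (rule ccontr)
      assume "\<not> d \<le> a"
      then have "p ^ Suc a dvd p ^ d" by (intro le_imp_power_dvd) simp
      then have "p ^ Suc a dvd p ^ a"
        using dvd that(3) by (metis dvd_add dvd_add_left_iff)
      then show False using p by (simp add: dvd_imp_le nat_dvd_not_less)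
    qed
    then have "p ^ a + p ^ d \<le> 2 * p ^ a" using p by (simp add: power_increasing)
    also have "\<dots> < p ^ Suc a" using p by simp
    also have "\<dots> \<le> p ^ c" using that p by (intro power_increasing) auto
    finally show False using that(3) by simp
  qed
  have inj: "p ^ x = p ^ y \<Longrightarrow> x = y" for x y using p by simp
  have "a = c \<or> a < c \<and> a < b \<or> b < a \<and> b < d \<or> c < a \<and> c < d \<or> d < b \<and> d < c \<or> b = d \<or> c = d"
    using assms(2) by presburger
  then consider "a = c" | "a < c" "a < b" | "b < a" "b < d" | "c < a" "c < d" | "d < b" "d < c"
    | "b = d" | "c = d"
    by blast
  then show ?thesis
  proof cases
    case 1 then show ?thesis using eq inj by auto
  next
    case 2 then show ?thesis using aux[of a c b d] eq by simp
  next
    case 3 then show ?thesis using aux[of b d a c] eq by simp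
  next
    case 4 then show ?thesis using aux[of c a d b] eq by simp
  next
    case 5 then show ?thesis using aux[of d b c a] eq by simp
  next
    case 6 then show ?thesis using eq inj by auto
  next
    case 7 then show ?thesis using eq inj assms(2) by auto
  qed
qed

text \<open>Writing the additive map \<open>g\<close> and a nonzero additive map vanishing on \<open>V\<close> as linearized
  polynomials, the hypothesis says that a polynomial with exponents \<open>p ^ a - p ^ j\<close>, shifted by
  \<open>p ^ (d - 1)\<close>, has all field elements as roots. For odd \<open>p\<close> its degree is below the order of the
  field and the exponents with \<open>a \<noteq> j\<close> are distinct.\<close>
lemma additive_quotient_proper:
  fixes V :: "'a::finite_field set"
  assumes odd: "odd CHAR('a)"
    and V: "add_closed V" "V \<noteq> UNIV"
    and g: "\<And>x y. g (x + y) = g x + g y"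
    and gV: "\<And>s. s \<noteq> 0 \<Longrightarrow> g s / s \<in> V"
  shows "g s = g 1 * s"
proof -
  let ?p = "CHAR('a)"
  have gt1: "?p > 1" using CHAR_prime[where 'a='a] prime_gt_1_nat by blast
  have gt2: "?p > 2" using gt1 odd by (metis even_numeral linorder_neqE_nat not_less_eq numeral_2_eq_2 One_nat_def less_SucE)
  have "add_closed (UNIV :: 'a set)" by (simp add: add_closed_def)
  then obtain d where d: "card (UNIV :: 'a set) = ?p ^ d"
    "\<And>g. (\<And>x y. g (x + y) = g x + g y) \<Longrightarrow> \<exists>P. linearized d P \<and> (\<forall>s\<in>(UNIV :: 'a set). g s = P s)"
    using additive_flag[of "UNIV :: 'a set"] by metis
  have lin: "linearized d h" if h: "\<And>x y. h (x + y) = h x + h y" for h :: "'a \<Rightarrow> 'a"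
  proof -
    obtain P where "linearized d P" "\<And>s. h s = P s" using d(2)[of h, OF h] by blast
    moreover from this have "h = P" by blast
    ultimately show ?thesis by simp
  qed
  obtain e Q where e: "card V = ?p ^ e" "linearized e Q"
    and Q: "\<And>s. s \<in> V \<Longrightarrow> s ^ (?p ^ e) + Q s = 0"
    using additive_flag[OF V(1)] by metis
  have "card V < card (UNIV :: 'a set)" using V(2) by (intro psubset_card_mono) auto
  then have "e < d" unfolding e d using gt1 by simp
  obtain c' where c': "\<And>s. Q s = (\<Sum>i<e. c' i * s ^ (?p ^ i))"
    using e(2) unfolding linearized_def by blast
  define c where "c = c'(e := 1)"
  have cV: "(\<Sum>j\<le>e. c j * s ^ (?p ^ j)) = 0" if "s \<in> V" for s
    using Q[OF that] unfolding c' c_def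
    by (simp add: lessThan_Suc_atMost[symmetric] add.commute)
  have "linearized d (\<lambda>s. g s ^ (?p ^ j))" for j
    by (rule lin) (simp add: g freshmans_dream'[OF CHAR_prime refl])
  then have "\<forall>j. \<exists>E. \<forall>s. g s ^ (?p ^ j) = (\<Sum>a<d. E a * s ^ (?p ^ a))"
    unfolding linearized_def by blast
  then obtain E where E: "\<And>j s. g s ^ (?p ^ j) = (\<Sum>a<d. E j a * s ^ (?p ^ a))" by metis
  \<comment> \<open>The largest p^j with j < d: multiplication by s^N clears all denominators
    s^(p^j), and exponents stay at most 2 N, below p N, the order of the field.\<close>
  define N where "N = ?p ^ (d - 1)"
  have pN: "?p ^ j \<le> N" if "j < d" for j
    unfolding N_def using that gt1 by (intro power_increasing) auto
  define f where "f = (\<Sum>j\<le>e. \<Sum>a<d. monom (c j * E j a) (?p ^ a + (N - ?p ^ j)))"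
  have root: "poly f s = 0" for s
  proof (cases "s = 0")
    case True
    have "poly (monom u (?p ^ a + k)) (0 :: 'a) = 0" for u a k
      using gt1 by (simp add: poly_monom)
    then show ?thesis unfolding True f_def poly_sum by simp
  next
    case False
    have "poly f s = (\<Sum>j\<le>e. s ^ (N - ?p ^ j) * c j * g s ^ (?p ^ j))"
      unfolding f_def poly_sum poly_monom E sum_distrib_left
      by (simp add: power_add mult_ac)
    also have "\<dots> = (\<Sum>j\<le>e. s ^ N * (c j * (g s / s) ^ (?p ^ j)))"
    proof (rule sum.cong[OF refl])
      fix j assume "j \<in> {..e}"
      then have "?p ^ j \<le> N" using pN \<open>e < d\<close> by simp
      then have "s ^ N = s ^ (N - ?p ^ j) * s ^ (?p ^ j)" by (simp flip: power_add)
      then show "s ^ (N - ?p ^ j) * c j * g s ^ (?p ^ j) = s ^ N * (c j * (g s / s) ^ (?p ^ j))"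
        using False by (simp add: power_divide)
    qed
    also have "\<dots> = 0"
      unfolding sum_distrib_left[symmetric] using cV[OF gV[OF False]] by simp
    finally show ?thesis .
  qed
  have "f = 0"
  proof (rule poly_eqI_degree[of UNIV])
    have "?p ^ a + (N - ?p ^ j) \<le> 2 * N" if "a < d" for a j
      using pN[OF that] by simp
    then have "degree f \<le> 2 * N"
      unfolding f_def by (intro degree_sum_le) (auto intro!: order.trans[OF degree_monom_le])
    also have "2 * N < ?p * N" using gt2 gt1 unfolding N_def by simp
    also have "?p * N = card (UNIV :: 'a set)"
      unfolding d N_def using \<open>e < d\<close> by (simp flip: power_Suc)
    finally show "degree f < card (UNIV :: 'a set)" .
    then show "degree (0 :: 'a poly) < card (UNIV :: 'a set)" by simp
  qed (use root in simp)
  \<comment> \<open>For a distinct from e, the monomial with exponent p^a + N - p^e arises from the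
    pair (e, a) alone, and its coefficient is \<open>E e a\<close> because
    \<open>c e = 1\<close>.\<close>
  have Ezero: "E e a = 0" if a: "a < d" "a \<noteq> e" for a
  proof -
    have iff: "?p ^ a' + (N - ?p ^ j) = ?p ^ a + (N - ?p ^ e) \<longleftrightarrow> a' = a \<and> j = e"
      if "a' < d" "j \<le> e" for a' j
    proof
      assume eq: "?p ^ a' + (N - ?p ^ j) = ?p ^ a + (N - ?p ^ e)"
      have "?p ^ j \<le> N" "?p ^ e \<le> N" using pN \<open>e < d\<close> that by auto
      then have "?p ^ a + ?p ^ j = ?p ^ a' + ?p ^ e" using eq by linarith
      from power_diff_inj[OF gt2 a(2) this] show "a' = a \<and> j = e" by simp
    qed auto
    have "0 = coeff f (?p ^ a + (N - ?p ^ e))" using \<open>f = 0\<close> by simp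
    also have "\<dots> = (\<Sum>j\<le>e. \<Sum>a'<d. if a' = a \<and> j = e then c j * E j a' else 0)"
      unfolding f_def coeff_sum coeff_monom by (intro sum.cong refl) (simp add: iff)
    also have "\<dots> = (\<Sum>j\<le>e. if j = e then c e * E e a else 0)"
      using a by (intro sum.cong refl) (auto simp: sum.delta)
    also have "\<dots> = E e a" by (simp add: c_def)
    finally show ?thesis by simp
  qed
  have diag: "g s ^ (?p ^ e) = E e e * s ^ (?p ^ e)" for s
  proof -
    have "g s ^ (?p ^ e) = (\<Sum>a<d. if a = e then E e e * s ^ (?p ^ e) else 0)"
      unfolding E by (intro sum.cong refl) (simp add: Ezero)
    then show ?thesis using \<open>e < d\<close> by simp
  qed
  \<comment> \<open>Only the diagonal coefficient survives, so \<open>g s\<close> and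
    \<open>g 1 * s\<close> have the same p^e-th power; the Frobenius map is injective.\<close>
  have "(g s - g 1 * s) ^ (?p ^ e) + (g 1 * s) ^ (?p ^ e) = g s ^ (?p ^ e)"
    by (subst freshmans_dream'[OF CHAR_prime refl, symmetric]) simp
  then have "(g s - g 1 * s) ^ (?p ^ e) = 0"
    using diag[of s] diag[of 1] by (simp add: power_mult_distrib)
  then show ?thesis by simp
qed

text \<open>The additivity hypothesis at the base points 0 and 1 already makes \<open>f\<close> additive; then both \<open>f\<close>
  and its conjugate by inversion are additive, and \<open>1 / t - 1 / (t + 1) = 1 / (t\<^sup>2 + t)\<close> gives
  \<open>f (t\<^sup>2) = (f t)\<^sup>2\<close> as in Hua's theorem.\<close>
lemma inversive_additive_imp_automorphism:
  fixes f :: "'a::field \<Rightarrow> 'a"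
  assumes two: "(2 :: 'a) \<noteq> 0"
    and inj: "inj f" and f0: "f 0 = 0" and f1: "f 1 = 1"
    and add: "\<And>x a b. 1 / (f (x + 1 / (a + b)) - f x) = 1 / (f (x + 1 / a) - f x) + 1 / (f (x + 1 / b) - f x)"
  shows "f (a + b) = f a + f b" and "f (a * b) = f a * f b"
proof -
  define L where "L a = 1 / f (1 / a)" for a
  have L: "L (a + b) = L a + L b" for a b
    using add[of 0 a b] by (simp add: f0 L_def)
  have fz: "f x = 0 \<longleftrightarrow> x = 0" for x using inj f0 by (metis injD)
  have fo: "f x = 1 \<longleftrightarrow> x = 1" for x using inj f1 by (metis injD)
  have fL: "f x = 1 / L (1 / x)" for x by (simp add: L_def)
  \<comment> \<open>Base point 1 is reduced to base point 0 through 1 + 1 / v = 1 / (v / (v + 1))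
    and additivity of \<open>L\<close>. The values v = 0 and v = -1 are separate because of 1 / 0 =
    0.\<close>
  have L1: "1 / (f (1 + 1 / v) - f 1) = f (v + 1) - 1" for v
  proof -
    consider "v = 0" | "v = -1" | "v \<noteq> 0" "v \<noteq> -1" by blast
    then show ?thesis
    proof cases
      case 1 then show ?thesis by (simp add: f1)
    next
      case 2 then show ?thesis by (simp add: f0 f1)
    next
      case 3
      then have v: "v \<noteq> 0" "v + 1 \<noteq> 0" by (auto simp: eq_neg_iff_add_eq_0)
      have nz: "f (v + 1) \<noteq> 0" "f (v + 1) \<noteq> 1" using fz fo v by auto
      have "1 + 1 / v = 1 / (v / (v + 1))" using v by (simp add: field_simps)
      then have "f (1 + 1 / v) = 1 / L (v / (v + 1))" by (simp add: L_def)
      also have "L (v / (v + 1)) + L (1 / (v + 1)) = L 1"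
        unfolding L[symmetric] using v by (simp flip: add_divide_distrib)
      then have "L (v / (v + 1)) = 1 - 1 / f (v + 1)"
        by (simp add: L_def f1 eq_diff_eq)
      finally have "f (1 + 1 / v) = 1 / (1 - 1 / f (v + 1))" .
      moreover have "1 / (1 - 1 / y) - 1 = 1 / (y - 1)" if "y \<noteq> 0" "y \<noteq> 1" for y :: 'a
      proof -
        have "1 - 1 / y = (y - 1) / y" using that by (simp add: diff_divide_distrib)
        then show ?thesis using that by (simp add: divide_simps)
      qed
      ultimately show ?thesis using nz unfolding f1 by (simp add: f1)
    qed
  qed
  have A: "f (a + b + 1) - 1 = (f (a + 1) - 1) + (f (b + 1) - 1)" for a b
    using add[of 1 a b] unfolding L1 .
  have shift: "f (a + 1) = f a + 1" for a
    using A[of a "-1"] by (simp add: f0 add.commute)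
  show fadd: "f (a + b) = f a + f b" for a b
    using A[of a b] by (simp add: shift)
  have sq: "f (t * t) = f t * f t" for t
  proof -
    consider "t = 0" | "t = -1" | "t \<noteq> 0" "t \<noteq> -1" by blast
    then show ?thesis
    proof cases
      case 1 then show ?thesis by (simp add: f0)
    next
      case 2
      have "f (-1) + 1 = f 0" using shift[of "-1"] by simp
      then have "f (-1) = -1" by (simp add: f0 eq_neg_iff_add_eq_0)
      then show ?thesis using 2 by (simp add: f1)
    next
      case 3
      then have t: "t \<noteq> 0" "t + 1 \<noteq> 0" by (auto simp: eq_neg_iff_add_eq_0)
      then have nz: "f t \<noteq> 0" "f t + 1 \<noteq> 0" using fz shift by metis+
      have "L (1 / (t * (t + 1))) + L (1 / (t + 1)) = L (1 / t)"
      proof -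
        have "1 / (t * (t + 1)) + 1 / (t + 1) = (1 + t) / (t * (t + 1))"
          using t by (simp add: add_divide_distrib)
        also have "\<dots> = 1 / t" using t by (simp add: add.commute)
        finally show ?thesis unfolding L[symmetric] by simp
      qed
      then have eq: "1 / f (t * (t + 1)) + 1 / (f t + 1) = 1 / f t"
        by (simp add: L_def shift)
      have "f (t * (t + 1)) \<noteq> 0" using t fz by simp
      then have "f (t * (t + 1)) = f t * (f t + 1)"
        using eq nz by (simp add: field_simps)
      moreover have "f (t * (t + 1)) = f (t * t) + f t"
        by (simp add: distrib_left fadd)
      ultimately show ?thesis by (simp add: distrib_left)
    qed
  qed
  show "f (a * b) = f a * f b"
  proof -
    \<comment> \<open>Polarization of \<open>sq\<close>; the factor 2 can be cancelled.\<close>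
    have "f ((a + b) * (a + b)) = f (a * a) + f (b * b) + (f (a * b) + f (a * b))"
      unfolding fadd[symmetric] by (simp add: algebra_simps)
    then have "2 * f (a * b) = 2 * (f a * f b)"
      unfolding sq fadd by (auto simp: algebra_simps)
    then show ?thesis using two by (metis mult_left_cancel)
  qed
qed

section \<open>The residue field of a finite ring\<close>

lemma is_ideal_principal: "is_ideal {a * r | r::'a::comm_ring_1. True}"
  unfolding is_ideal_def
proof (intro conjI allI ballI)
  show "0 \<in> {a * r | r::'a. True}" by (auto intro: exI[of _ 0])
  fix x y assume "x \<in> {a * r | r::'a. True}" "y \<in> {a * r | r::'a. True}"
  then obtain r s where "x = a * r" "y = a * s" by blast
  then have "x + y = a * (r + s)" by (simp add: distrib_left)
  then show "x + y \<in> {a * r | r::'a. True}" by blast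
next
  fix r x assume "x \<in> {a * r | r::'a. True}"
  then obtain s where "x = a * s" by blast
  then have "r * x = a * (r * s)" by (simp add: mult_ac)
  then show "r * x \<in> {a * r | r::'a. True}" by blast
qed

lemma exists_maximal_ideal:
  fixes I :: "'a::{comm_ring_1,finite} set"
  assumes "is_ideal I" "1 \<notin> I"
  obtains M where "maximal_ideal M" "I \<subseteq> M"
proof -
  obtain M where M: "is_ideal M" "1 \<notin> M" "I \<subseteq> M"
    and mx: "\<And>J. is_ideal J \<Longrightarrow> 1 \<notin> J \<Longrightarrow> I \<subseteq> J \<Longrightarrow> card J \<le> card M"
    using ex_has_greatest_nat[of "\<lambda>J. is_ideal J \<and> 1 \<notin> J \<and> I \<subseteq> J" I card "Suc (card (UNIV :: 'a set))"] assms
    by (auto simp: less_Suc_eq_le card_mono)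
  have "J = M \<or> J = UNIV" if J: "is_ideal J" "M \<subseteq> J" for J
  proof (cases "1 \<in> J")
    case True
    then have "r \<in> J" for r using J(1) unfolding is_ideal_def by (metis mult.right_neutral)
    then show ?thesis by blast
  next
    case False
    then have "card J \<le> card M" using mx J M by blast
    then show ?thesis using card_seteq[OF _ J(2)] by simp
  qed
  then have "maximal_ideal M" unfolding maximal_ideal_def using M by blast
  then show ?thesis using that M by blast
qed

text \<open>The sort of a finite commutative ring guarantees a maximal ideal, so the residue field can be a
  type without any reference to locality; in a local ring the chosen ideal is the radical.\<close>
definition max_ideal :: "'a::{comm_ring_1,finite} itself \<Rightarrow> 'a set" where
  "max_ideal _ = (SOME M. maximal_ideal M)"

lemma maximal_max_ideal: "maximal_ideal (max_ideal TYPE('a::{comm_ring_1,finite}))"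
proof -
  have "is_ideal {0::'a}" by (simp add: is_ideal_def)
  then show ?thesis
    unfolding max_ideal_def by (metis exists_maximal_ideal insertE empty_iff zero_neq_one someI)
qed

lemma is_ideal_max_ideal: "is_ideal (max_ideal TYPE('a::{comm_ring_1,finite}))"
  using maximal_max_ideal unfolding maximal_ideal_def by blast

lemma max_ideal_simps:
  "(0::'a::{comm_ring_1,finite}) \<in> max_ideal TYPE('a)"
  "(x::'a) \<in> max_ideal TYPE('a) \<Longrightarrow> y \<in> max_ideal TYPE('a) \<Longrightarrow> x + y \<in> max_ideal TYPE('a)"
  "(x::'a) \<in> max_ideal TYPE('a) \<Longrightarrow> r * x \<in> max_ideal TYPE('a)"
  "(x::'a) \<in> max_ideal TYPE('a) \<Longrightarrow> x * r \<in> max_ideal TYPE('a)"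
  "(x::'a) \<in> max_ideal TYPE('a) \<Longrightarrow> - x \<in> max_ideal TYPE('a)"
  using is_ideal_max_ideal[where 'a='a] unfolding is_ideal_def
  by (auto simp: mult.commute) (metis mult_minus1)

lemma one_notin_max_ideal: "(1::'a::{comm_ring_1,finite}) \<notin> max_ideal TYPE('a)"
proof
  assume 1: "(1::'a) \<in> max_ideal TYPE('a)"
  have "r \<in> max_ideal TYPE('a)" for r using max_ideal_simps(3)[OF 1, of r] by simp
  then show False using maximal_max_ideal[where 'a='a] unfolding maximal_ideal_def by blast
qed

lemma inverse_mod_max_ideal:
  assumes "(x::'a::{comm_ring_1,finite}) \<notin> max_ideal TYPE('a)"
  shows "\<exists>y. x * y - 1 \<in> max_ideal TYPE('a)"
proof -
  let ?M = "max_ideal TYPE('a)" and ?J = "{x * r + m | r m. m \<in> max_ideal TYPE('a)}"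
  have "is_ideal ?J"
    unfolding is_ideal_def
  proof (intro conjI ballI allI)
    show "0 \<in> ?J" using max_ideal_simps(1) by (auto intro!: exI[of _ 0])
    fix a b assume "a \<in> ?J" "b \<in> ?J"
    then obtain r m s l where "a = x * r + m" "b = x * s + l" "m \<in> ?M" "l \<in> ?M" by blast
    then have "a + b = x * (r + s) + (m + l)" "m + l \<in> ?M"
      by (simp_all add: algebra_simps max_ideal_simps)
    then show "a + b \<in> ?J" by blast
  next
    fix c a assume "a \<in> ?J"
    then obtain r m where "a = x * r + m" "m \<in> ?M" by blast
    then have "c * a = x * (c * r) + c * m" "c * m \<in> ?M"
      by (simp_all add: algebra_simps max_ideal_simps)
    then show "c * a \<in> ?J" by blast
  qed
  moreover have "?M \<subseteq> ?J"
  proof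
    fix m assume "m \<in> ?M"
    then show "m \<in> ?J" by (intro CollectI exI[of _ 0] exI[of _ m]) simp
  qed
  moreover have "x \<in> ?J" using max_ideal_simps(1) by (intro CollectI exI[of _ 1] exI[of _ 0]) simp
  ultimately have "1 \<in> ?J"
    using assms maximal_max_ideal[where 'a='a] unfolding maximal_ideal_def by blast
  then obtain r m where "1 = x * r + m" "m \<in> ?M" by blast
  then have "x * r - 1 = - m" by (simp add: algebra_simps)
  then show ?thesis using max_ideal_simps(5)[OF \<open>m \<in> ?M\<close>] by metis
qed

definition max_ideal_rel :: "'a::{comm_ring_1,finite} \<Rightarrow> 'a \<Rightarrow> bool" where
  "max_ideal_rel x y \<longleftrightarrow> x - y \<in> max_ideal TYPE('a)"

lemma equivp_max_ideal_rel: "equivp max_ideal_rel"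
proof (rule equivpI)
  show "reflp (max_ideal_rel :: 'a \<Rightarrow> _)"
    by (simp add: reflp_def max_ideal_rel_def max_ideal_simps)
  show "symp (max_ideal_rel :: 'a \<Rightarrow> _)"
    unfolding symp_def max_ideal_rel_def by (metis max_ideal_simps(5) minus_diff_eq)
  show "transp (max_ideal_rel :: 'a \<Rightarrow> _)"
    unfolding transp_def max_ideal_rel_def by (metis max_ideal_simps(2) diff_add_cancel add_diff_eq)
qed

quotient_type (overloaded) 'a residue_field = "'a::{comm_ring_1,finite}" / max_ideal_rel
  morphisms rep_residue residue
  by (rule equivp_max_ideal_rel)

lemma max_ideal_rel_cong:
  assumes "max_ideal_rel a b" "max_ideal_rel c d"
  shows "max_ideal_rel (a + c) (b + d)" "max_ideal_rel (a * c) (b * d)"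
    "max_ideal_rel (a - c) (b - d)" "max_ideal_rel (- a) (- b)"
proof -
  have ab: "a - b \<in> max_ideal TYPE('a)" and cd: "c - d \<in> max_ideal TYPE('a)"
    using assms by (auto simp: max_ideal_rel_def)
  have "a + c - (b + d) = (a - b) + (c - d)" by simp
  then show "max_ideal_rel (a + c) (b + d)" unfolding max_ideal_rel_def
    using max_ideal_simps(2)[OF ab cd] by metis
  have "a - c - (b - d) = (a - b) + - (c - d)" by simp
  then show "max_ideal_rel (a - c) (b - d)" unfolding max_ideal_rel_def
    using max_ideal_simps(2)[OF ab max_ideal_simps(5)[OF cd]] by metis
  have "a * c - b * d = (a - b) * c + b * (c - d)" by (simp add: algebra_simps)
  then show "max_ideal_rel (a * c) (b * d)" unfolding max_ideal_rel_def
    using max_ideal_simps(2)[OF max_ideal_simps(4)[OF ab] max_ideal_simps(3)[OF cd]] by metis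
  have "- a - - b = - (a - b)" by simp
  then show "max_ideal_rel (- a) (- b)" unfolding max_ideal_rel_def
    using max_ideal_simps(5)[OF ab] by metis
qed

instantiation residue_field :: ("{comm_ring_1,finite}") comm_ring_1
begin
lift_definition zero_residue_field :: "'a residue_field" is 0 .
lift_definition one_residue_field :: "'a residue_field" is 1 .
lift_definition plus_residue_field :: "'a residue_field \<Rightarrow> 'a residue_field \<Rightarrow> 'a residue_field"
  is "(+)" by (rule max_ideal_rel_cong)
lift_definition minus_residue_field :: "'a residue_field \<Rightarrow> 'a residue_field \<Rightarrow> 'a residue_field"
  is "(-)" by (rule max_ideal_rel_cong)
lift_definition uminus_residue_field :: "'a residue_field \<Rightarrow> 'a residue_field"
  is uminus by (rule max_ideal_rel_cong)
lift_definition times_residue_field :: "'a residue_field \<Rightarrow> 'a residue_field \<Rightarrow> 'a residue_field"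
  is "(*)" by (rule max_ideal_rel_cong)
instance
proof
  show "(0::'a residue_field) \<noteq> 1"
    by transfer (use max_ideal_simps(5)[of "0 - 1 :: 'a"] one_notin_max_ideal in \<open>auto simp: max_ideal_rel_def\<close>)
qed (transfer; simp add: algebra_simps equivp_reflp[OF equivp_max_ideal_rel])+
end

lemma residue_eq_iff: "residue x = residue y \<longleftrightarrow> x - y \<in> max_ideal TYPE('a)"
  for x y :: "'a::{comm_ring_1,finite}"
  by (simp add: residue_field.abs_eq_iff max_ideal_rel_def)

lemma residue_hom:
  "residue 0 = 0" "residue 1 = 1" "residue (x + y) = residue x + residue y"
  "residue (x - y) = residue x - residue y" "residue (- x) = - residue x"
  "residue (x * y) = residue x * residue y"
  by (simp_all add: zero_residue_field.abs_eq one_residue_field.abs_eq plus_residue_field.abs_eq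
      minus_residue_field.abs_eq uminus_residue_field.abs_eq times_residue_field.abs_eq)

lemma residue_surj: "\<exists>x. residue x = a"
  by (metis Quotient_residue_field Quotient_abs_rep)

lemma residue_eq_0_iff: "residue x = 0 \<longleftrightarrow> x \<in> max_ideal TYPE('a)"
  for x :: "'a::{comm_ring_1,finite}"
  using residue_eq_iff[of x 0] by (simp add: residue_hom)

lemma exists_inverse_residue_field:
  assumes "(a :: 'a::{comm_ring_1,finite} residue_field) \<noteq> 0"
  shows "\<exists>b. a * b = 1"
proof -
  obtain x where x: "a = residue x" using residue_surj by metis
  then obtain y where "x * y - 1 \<in> max_ideal TYPE('a)"
    using assms inverse_mod_max_ideal[of x] by (auto simp: residue_eq_0_iff)
  then have "residue (x * y) = residue 1" by (simp add: residue_eq_iff)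
  then show ?thesis unfolding x by (metis residue_hom(2,6))
qed

instantiation residue_field :: ("{comm_ring_1,finite}") field
begin
definition inverse_residue_field :: "'a residue_field \<Rightarrow> 'a residue_field" where
  "inverse_residue_field a = (if a = 0 then 0 else (SOME b. a * b = 1))"
definition divide_residue_field :: "'a residue_field \<Rightarrow> 'a residue_field \<Rightarrow> 'a residue_field" where
  "divide_residue_field a b = a * inverse b"
instance
proof
  fix a :: "'a residue_field" assume "a \<noteq> 0"
  then show "inverse a * a = 1"
    using someI_ex[OF exists_inverse_residue_field[of a]]
    by (simp add: inverse_residue_field_def mult.commute)
qed (simp_all add: divide_residue_field_def inverse_residue_field_def)
end

instance residue_field :: ("{comm_ring_1,finite}") finite_field
proof (rule finite_fieldI)
  have "(UNIV :: 'a residue_field set) = range residue" using residue_surj by (metis UNIV_eq_I rangeI)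
  then show "finite (UNIV :: 'a residue_field set)" by (metis finite_imageI finite)
qed

section \<open>Galois rings and the layers of a unit group\<close>

definition differ :: "'a::comm_ring_1 \<Rightarrow> ('a \<Rightarrow> 'b::comm_ring_1) \<Rightarrow> 'a \<Rightarrow> 'b" where
  "differ s F x = F (x + s) - F x"

lemma differ_commute: "differ s (differ t F) = differ t (differ s F)"
  by (rule ext) (simp add: differ_def algebra_simps)

lemma differ_funpow_commute: "(differ u ^^ i) (differ s F) = differ s ((differ u ^^ i) F)"
  by (induction i) (simp_all add: differ_commute)

text \<open>With E the translation by u, \<open>differ u\<close> is E - 1, and this is the binomial
  expansion of (E - 1)^i.\<close>

lemma differ_funpow_eq:
  "(differ u ^^ i) (G :: 'a::comm_ring_1 \<Rightarrow> 'b::comm_ring_1) x =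
    (\<Sum>k\<le>i. of_nat (i choose k) * (-1) ^ (i - k) * G (x + of_nat k * u))"
proof (induction i arbitrary: x)
  case (Suc i)
  let ?c = "\<lambda>i k. of_nat (i choose k) * (-1) ^ (i - k) :: 'b"
  let ?G = "\<lambda>k. G (x + of_nat k * u)"
  have "(differ u ^^ Suc i) G x = (\<Sum>k\<le>i. ?c i k * ?G (Suc k)) - (\<Sum>k\<le>i. ?c i k * ?G k)"
    by (simp add: differ_def Suc.IH algebra_simps)
  also have "(\<Sum>k\<le>i. ?c i k * ?G k) = ?c i 0 * ?G 0 + (\<Sum>k\<le>i. ?c i (Suc k) * ?G (Suc k))"
    by (subst sum.atMost_Suc_shift[symmetric]) (simp add: binomial_eq_0)
  also have "(\<Sum>k\<le>i. ?c i k * ?G (Suc k)) - (?c i 0 * ?G 0 + (\<Sum>k\<le>i. ?c i (Suc k) * ?G (Suc k)))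
    = ?c (Suc i) 0 * ?G 0 + (\<Sum>k\<le>i. ?c (Suc i) (Suc k) * ?G (Suc k))"
  proof -
    have "?c i k * ?G (Suc k) - ?c i (Suc k) * ?G (Suc k) = ?c (Suc i) (Suc k) * ?G (Suc k)"
      if "k \<le> i" for k
    proof (cases "k = i")
      case False
      then have "i - k = Suc (i - Suc k)" using that by simp
      then show ?thesis by (simp add: algebra_simps)
    qed (simp add: binomial_eq_0)
    then have "(\<Sum>k\<le>i. ?c i k * ?G (Suc k)) - (\<Sum>k\<le>i. ?c i (Suc k) * ?G (Suc k))
        = (\<Sum>k\<le>i. ?c (Suc i) (Suc k) * ?G (Suc k))"
      unfolding sum_subtractf[symmetric] by (intro sum.cong refl) simp
    moreover have "?c (Suc i) 0 * ?G 0 = - (?c i 0 * ?G 0)" by simp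
    moreover have "s1 - (a + s2) = c + s3" if "s1 - s2 = s3" "c = - a" for s1 s2 s3 a c :: 'b
      using that by simp
    ultimately show ?thesis by blast
  qed
  also have "\<dots> = (\<Sum>k\<le>Suc i. ?c (Suc i) k * ?G k)"
    by (subst sum.atMost_Suc_shift) simp
  finally show ?case .
qed simp

text \<open>From k C(p^N, k) = p^N C(p^N - 1, k - 1): a binomial coefficient prime to p would force
  p^N to divide k.\<close>

lemma prime_dvd_choose_prime_power:
  fixes p :: nat
  assumes "prime p" "0 < k" "k < p ^ N"
  shows "p dvd (p ^ N choose k)"
proof (rule ccontr)
  assume "\<not> p dvd (p ^ N choose k)"
  then have "coprime (p ^ N) (p ^ N choose k)"
    using assms(1) by (simp add: prime_imp_coprime)
  moreover have "p ^ N dvd k * (p ^ N choose k)"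
    by (simp add: times_binomial_minus1_eq[OF assms(2)])
  ultimately have "p ^ N dvd k" by (simp add: coprime_dvd_mult_left_iff)
  then show False using assms by (auto dest: dvd_imp_le)
qed

lemma unit_subgroup_inverse:
  assumes "unit_subgroup K" "k \<in> K"
  obtains l where "l \<in> K" "k * l = 1"
  using assms unfolding unit_subgroup_def by blast

section \<open>Rings with maximal ideal pR: units, digits and layers\<close>

locale galois_setting =
  fixes p n :: nat and K :: "'a::{comm_ring_1,finite} set"
  assumes prime_p: "prime p" and odd_p: "odd p"
    and max_ideal_p: "max_ideal TYPE('a) = {of_nat p * r | r. True}"
    and nilp: "of_nat p ^ n = (0 :: 'a)" and nilp_minimal: "of_nat p ^ (n - 1) \<noteq> (0 :: 'a)"
    and K: "unit_subgroup K"
begin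

abbreviation P :: 'a where "P \<equiv> of_nat p"

lemma residue_0_iff: "residue x = 0 \<longleftrightarrow> P dvd x"
  unfolding residue_eq_0_iff max_ideal_p by (auto simp: dvd_def)

lemma residue_eq: "residue x = residue y \<longleftrightarrow> P dvd x - y"
  using residue_0_iff[of "x - y"] by (simp add: residue_hom)

lemma p_gt_2: "p > 2"
  using prime_p odd_p by (metis prime_ge_2_nat le_neq_implies_less even_numeral)

lemma residue_of_nat: "residue (of_nat k) = of_nat k"
  by (induction k) (simp_all add: residue_hom)

lemma CHAR_residue: "CHAR('a residue_field) = p"
proof -
  have "(of_nat p :: 'a residue_field) = 0" by (simp add: residue_of_nat[symmetric] residue_0_iff)
  then have "CHAR('a residue_field) dvd p" by (simp add: of_nat_eq_0_iff_char_dvd)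
  then show ?thesis using prime_p CHAR_prime[where 'a="'a residue_field"]
    by (metis primes_dvd_imp_eq)
qed

lemma two_nz: "(2 :: 'a residue_field) \<noteq> 0"
proof
  assume "(2 :: 'a residue_field) = 0"
  then have "of_nat 2 = (0 :: 'a residue_field)" by simp
  then have "p dvd 2" unfolding of_nat_eq_0_iff_char_dvd CHAR_residue .
  then show False using p_gt_2 by (auto dest: dvd_imp_le)
qed

lemma one_minus_P_unit: "1 - P * r dvd 1"
proof -
  have "1 = (1 - P * r) * (\<Sum>i<n. (P * r) ^ i)"
    using one_diff_power_eq[of "P * r" n] by (simp add: power_mult_distrib nilp)
  then show ?thesis by (rule dvdI)
qed

lemma unit_iff:
  fixes x :: 'a
  shows "x dvd 1 \<longleftrightarrow> residue x \<noteq> 0"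
proof
  assume "x dvd 1"
  then obtain y where "1 = x * y" by blast
  then have "residue x * residue y = 1" by (metis residue_hom(2,6))
  then show "residue x \<noteq> 0" by auto
next
  assume "residue x \<noteq> 0"
  then obtain y :: 'a where "residue x * residue y = 1"
    using exists_inverse_residue_field residue_surj by metis
  then have "residue (x * y) = residue 1" by (simp add: residue_hom)
  then obtain r where "x * y - 1 = P * r" unfolding residue_eq by blast
  then have "x * y = 1 - P * (- r)" by (simp add: algebra_simps)
  then show "x dvd 1" using one_minus_P_unit by (metis dvd_mult_left)
qed

lemma K_unit: "k \<in> K \<Longrightarrow> k dvd 1"
  using K unfolding unit_subgroup_def units_set_def by blast

lemma P_power_unit_nz: "m < n \<Longrightarrow> u dvd 1 \<Longrightarrow> P ^ m * u \<noteq> 0"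
proof
  assume "m < n" "u dvd 1" "P ^ m * u = 0"
  then obtain v where "u * v = 1" by (metis dvdE)
  then have "P ^ m = (P ^ m * u) * v" by (simp add: mult.assoc)
  then have "P ^ m = 0" using \<open>P ^ m * u = 0\<close> by simp
  moreover have "P ^ m dvd P ^ (n - 1)" using \<open>m < n\<close> by (intro le_imp_power_dvd) simp
  ultimately show False using nilp_minimal by simp
qed

text \<open>The digit of y at p^m, realizing the isomorphism of p^m R / p^(m+1) R with the residue
  field. For m < n the chosen quotient is irrelevant, since p^m annihilates no unit; outside p^m R
  the value carries no meaning.\<close>

definition res :: "nat \<Rightarrow> 'a \<Rightarrow> 'a residue_field" where
  "res m y = residue (SOME z. y = P ^ m * z)"

lemma res_eq [simp]:
  assumes "m < n"
  shows "res m (P ^ m * z) = residue z"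
proof -
  define z' where "z' = (SOME z'. P ^ m * z = P ^ m * z')"
  have "P ^ m * z = P ^ m * z'" unfolding z'_def by (rule someI[of _ z]) simp
  then have "P ^ m * (z' - z) = 0" by (simp add: algebra_simps)
  then have "residue (z' - z) = 0" using P_power_unit_nz[OF assms] unit_iff by blast
  then show ?thesis unfolding res_def z'_def by (simp add: residue_hom)
qed

lemma res_add:
  assumes "m < n" "P ^ m dvd x" "P ^ m dvd y"
  shows "res m (x + y) = res m x + res m y"
proof -
  obtain a b where "x = P ^ m * a" "y = P ^ m * b" using assms by blast
  moreover from this have "x + y = P ^ m * (a + b)" by (simp add: distrib_left)
  ultimately show ?thesis using assms(1) by (simp add: residue_hom)
qed

lemma res_diff:
  assumes "m < n" "P ^ m dvd x" "P ^ m dvd y"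
  shows "res m (x - y) = res m x - res m y"
  using res_add[OF assms(1), of "x - y" y] assms by simp

lemma res_0_iff:
  assumes "m < n" "P ^ m dvd x"
  shows "res m x = 0 \<longleftrightarrow> P ^ Suc m dvd x"
proof
  obtain a where a: "x = P ^ m * a" using assms by blast
  { assume "res m x = 0"
    then have "P dvd a" using a assms(1) by (simp add: residue_0_iff)
    then show "P ^ Suc m dvd x" unfolding a by (simp add: mult.commute mult_dvd_mono) }
  assume "P ^ Suc m dvd x"
  then obtain b where "x = P ^ m * (P * b)" by (auto simp: dvd_def mult_ac)
  then show "res m x = 0" using assms(1) by (simp add: residue_0_iff)
qed

lemma res_cong:
  assumes "m < n" "P ^ m dvd x" "P ^ Suc m dvd x - y"
  shows "res m x = res m y"
proof -
  have *: "P ^ m dvd x - y" using assms(3) by (meson dvd_trans le_imp_power_dvd le_SucI order_refl)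
  then have "P ^ m dvd y" using assms(2) by (metis dvd_diff diff_diff_eq2 add_diff_cancel_left')
  then show ?thesis using res_0_iff[OF assms(1) *] res_diff[OF assms(1,2)] assms(3) by simp
qed

text \<open>The layer of \<open>K\<close> between \<open>1 + p\<^sup>m R\<close> and \<open>1 + p\<^sup>m\<^sup>+\<^sup>1 R\<close>.\<close>
definition layer :: "nat \<Rightarrow> 'a residue_field set" where
  "layer m = {residue z | z. \<exists>k\<in>K. P ^ Suc m dvd 1 + P ^ m * z - k}"

text \<open>(1 + p^m y)(1 + p^m z) agrees with 1 + p^m (y + z) modulo p^(2m), and 2m is at least m +
  1.\<close>

lemma layer_closed:
  assumes "m \<ge> 1"
  shows "add_closed (layer m)"
  unfolding add_closed_def
proof (intro conjI ballI)
  show "0 \<in> layer m"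
    unfolding layer_def using K
    by (auto simp: unit_subgroup_def residue_hom(1) intro!: exI[of _ 0] bexI[of _ 1])
  fix a b assume "a \<in> layer m" "b \<in> layer m"
  then obtain y z k l where a: "a = residue y" "k \<in> K" "P ^ Suc m dvd 1 + P ^ m * y - k"
    and b: "b = residue z" "l \<in> K" "P ^ Suc m dvd 1 + P ^ m * z - l"
    unfolding layer_def by blast
  have "P ^ Suc m dvd P ^ m * P ^ m"
    using assms by (simp flip: power_add power_Suc add: le_imp_power_dvd del: power_Suc)
  moreover have "1 + P ^ m * (y + z) - k * l =
     (1 + P ^ m * y - k) * l + (1 + P ^ m * y) * (1 + P ^ m * z - l) - P ^ m * P ^ m * (y * z)"
    by (simp add: algebra_simps)
  ultimately have "P ^ Suc m dvd 1 + P ^ m * (y + z) - k * l"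
    using a b by (metis dvd_add dvd_diff dvd_mult dvd_mult2)
  moreover have "k * l \<in> K" using a b K by (auto simp: unit_subgroup_def)
  ultimately show "a + b \<in> layer m"
    unfolding layer_def a b residue_hom[symmetric] by blast
qed

text \<open>For 1 < k < p the binomial coefficient contributes one p and i k is at least i + 1. The
  last term has no such coefficient and needs i p to be at least i + 2, which uses p > 2.\<close>

lemma p_power_one_plus:
  assumes "i \<ge> 1"
  shows "P ^ Suc (Suc i) dvd (1 + P ^ i * w) ^ p - (1 + P ^ Suc i * w)"
proof -
  let ?t = "P ^ i * w"
  have "(1 + ?t) ^ p = (\<Sum>k\<le>p. of_nat (p choose k) * ?t ^ k)"
    using binomial_ring[of ?t 1 p] by (simp add: add.commute)
  also have "{..p} = insert 0 (insert 1 {2..p})" using p_gt_2 by auto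
  also have "(\<Sum>k\<in>\<dots>. of_nat (p choose k) * ?t ^ k) =
      1 + P ^ Suc i * w + (\<Sum>k\<in>{2..p}. of_nat (p choose k) * ?t ^ k)"
    by (simp add: algebra_simps)
  finally have "(1 + ?t) ^ p - (1 + P ^ Suc i * w) = (\<Sum>k\<in>{2..p}. of_nat (p choose k) * ?t ^ k)"
    by simp
  also have "P ^ Suc (Suc i) dvd \<dots>"
  proof (rule dvd_sum)
    fix k assume k: "k \<in> {2..p}"
    show "P ^ Suc (Suc i) dvd of_nat (p choose k) * ?t ^ k"
    proof (cases "k = p")
      case True
      have "Suc (Suc i) \<le> i * 3" using assms by simp
      also have "\<dots> \<le> i * p" using p_gt_2 by simp
      finally have "P ^ Suc (Suc i) dvd (P ^ i) ^ p"
        unfolding power_mult[symmetric] by (rule le_imp_power_dvd)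
      then show ?thesis using True by (simp add: power_mult_distrib)
    next
      case False
      then have "p dvd (p choose k)" using k prime_p by (intro dvd_choose_prime) auto
      then have 1: "P dvd of_nat (p choose k)" by (metis of_nat_mult dvd_def)
      have "Suc i \<le> i * 2" using assms by simp
      also have "\<dots> \<le> i * k" using k by simp
      finally have "P ^ Suc i dvd (P ^ i) ^ k"
        unfolding power_mult[symmetric] by (rule le_imp_power_dvd)
      then have "P ^ Suc i dvd ?t ^ k" by (simp add: power_mult_distrib)
      from mult_dvd_mono[OF 1 this] show ?thesis by simp
    qed
  qed
  finally show ?thesis .
qed

lemma layer_proper:
  assumes "pure K" and m: "1 \<le> m" "m < n"
  shows "layer m \<noteq> UNIV"
proof
  assume full: "layer m = UNIV"
  \<comment> \<open>Fullness climbs one level at a time: an element of K equal to 1 + p^i (z - p y)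
    has p-th power 1 + p^(i+1) z modulo p^(i+2).\<close>
  have all: "\<forall>z. \<exists>k\<in>K. P ^ Suc i dvd 1 + P ^ i * z - k" if "m \<le> i" for i
    using that
  proof (induction i rule: dec_induct)
    case base
    show ?case
    proof
      fix z
      have "residue z \<in> layer m" using full by simp
      then obtain y k where y: "residue z = residue y" "k \<in> K" "P ^ Suc m dvd 1 + P ^ m * y - k"
        unfolding layer_def by blast
      then have "P ^ m * P dvd P ^ m * (z - y)" by (simp add: residue_eq mult_dvd_mono)
      then have "P ^ Suc m dvd P ^ m * (z - y)" by (simp add: mult.commute)
      moreover have "1 + P ^ m * z - k = (1 + P ^ m * y - k) + P ^ m * (z - y)"
        by (simp add: algebra_simps)
      ultimately show "\<exists>k\<in>K. P ^ Suc m dvd 1 + P ^ m * z - k" using y by (metis dvd_add)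
    qed
  next
    case (step i)
    show ?case
    proof
      fix z
      obtain k y where k: "k \<in> K" "1 + P ^ i * z - k = P ^ Suc i * y" using step.IH by blast
      have keq: "k = 1 + P ^ i * (z - P * y)"
        using k(2) by (simp add: algebra_simps)
      have "P ^ Suc (Suc i) dvd k ^ p - (1 + P ^ Suc i * (z - P * y))"
        unfolding keq by (rule p_power_one_plus) (use m step in simp)
      moreover have "1 + P ^ Suc i * z - k ^ p =
          P ^ Suc (Suc i) * y - (k ^ p - (1 + P ^ Suc i * (z - P * y)))"
        by (simp add: algebra_simps)
      moreover have "k ^ j \<in> K" for j
        using K k(1) by (induction j) (auto simp: unit_subgroup_def)
      ultimately show "\<exists>k\<in>K. P ^ Suc (Suc i) dvd 1 + P ^ Suc i * z - k"
        by (metis dvd_diff dvd_triv_left)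
    qed
  qed
  \<comment> \<open>At level n - 1 the congruence is modulo p^n = 0, so it is an equality.\<close>
  have inK: "1 + P ^ (n - 1) * z \<in> K" for z
  proof -
    have "Suc (n - 1) = n" using m by simp
    then obtain k where "k \<in> K" "1 + P ^ (n - 1) * z - k = 0"
      using all[of "n - 1"] m nilp by (metis dvd_0_left Suc_leI Suc_le_mono)
    then show ?thesis by simp
  qed
  define I where "I = {P ^ (n - 1) * r | r. True}"
  have "{k + i | k i. k \<in> K \<and> i \<in> I} = K"
  proof (intro equalityI subsetI)
    fix x assume "x \<in> {k + i | k i. k \<in> K \<and> i \<in> I}"
    then obtain k r where k: "k \<in> K" "x = k + P ^ (n - 1) * r" unfolding I_def by blast
    obtain l where l: "l \<in> K" "k * l = 1" using unit_subgroup_inverse[OF K k(1)] .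
    have "x = k * (1 + P ^ (n - 1) * (l * r))"
      unfolding k using l(2) by (simp add: algebra_simps) (simp add: mult.assoc[symmetric])
    then show "x \<in> K" using K k inK[of "l * r"] by (simp add: unit_subgroup_def)
  next
    fix k assume "k \<in> K"
    moreover have "0 \<in> I" unfolding I_def by (auto intro: exI[of _ 0])
    ultimately show "k \<in> {k + i | k i. k \<in> K \<and> i \<in> I}" by (intro CollectI exI[of _ k] exI[of _ 0]) simp
  qed
  then have "I = {0}"
    using \<open>pure K\<close> is_ideal_principal[of "P ^ (n - 1)"] unfolding pure_def I_def by blast
  moreover have "P ^ (n - 1) * 1 \<in> I" unfolding I_def by blast
  ultimately show False using nilp_minimal by simp
qed

text \<open>If u k - u = p^m c then k = 1 + p^m (c / u), so k itself witnesses membership. This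
  converts a comparison of two values of the map into a statement about one digit.\<close>

lemma layerI:
  assumes "m < n" "u dvd 1" "k \<in> K" "P ^ m dvd u * k - u"
  shows "res m (u * k - u) / residue u \<in> layer m"
proof -
  obtain c where c: "u * k - u = P ^ m * c" using assms by blast
  obtain v where v: "u * v = 1" using assms(2) by (metis dvdE)
  have "k = v * (u * k)" using v by (simp add: mult_ac flip: mult.assoc)
  also have "\<dots> = v * (u + P ^ m * c)" using c by (simp add: algebra_simps)
  finally have "k = 1 + P ^ m * (c * v)" using v by (simp add: algebra_simps)
  then have "residue (c * v) \<in> layer m" unfolding layer_def using assms(3)
    by (intro CollectI exI[of _ "c * v"] conjI refl bexI[of _ k]) simp_all
  moreover have "residue u * residue v = 1" using v by (metis residue_hom(2,6))
  then have "residue v = 1 / residue u" using assms(2)[unfolded unit_iff] by (simp add: field_simps)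
  ultimately show ?thesis unfolding c res_eq[OF assms(1)] by (simp add: residue_hom)
qed

end

section \<open>Automorphisms modulo \<open>p\<close>\<close>

locale normalized_cyclotomic_map = galois_setting p n K
  for p n :: nat and K :: "'a::{comm_ring_1,finite} set" +
  fixes f :: "'a \<Rightarrow> 'a"
  assumes n_ge_2: "n \<ge> 2" and pure_K: "pure K"
    and bij_f: "bij f" and f_0: "f 0 = 0" and f_1: "f 1 = 1"
    and f_diff: "\<exists>k\<in>K. f y - f x = (y - x) * k"
begin

lemma P_dvd_f_diff_iff: "P dvd f y - f x \<longleftrightarrow> P dvd y - x"
proof -
  obtain k where k: "k \<in> K" "f y - f x = (y - x) * k" using f_diff by blast
  have "residue k \<noteq> 0" using K_unit[OF k(1)] unit_iff by blast
  then show ?thesis unfolding residue_0_iff[symmetric] k(2) by (simp add: residue_hom)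
qed

lemma unit_f_diff_iff: "f y - f x dvd 1 \<longleftrightarrow> y - x dvd 1"
  unfolding unit_iff residue_0_iff P_dvd_f_diff_iff ..

lemma unit_f_iff: "f y dvd 1 \<longleftrightarrow> y dvd 1"
  using unit_f_diff_iff[of y 0] by (simp add: f_0)

definition fbar :: "'a residue_field \<Rightarrow> 'a residue_field" where
  "fbar a = residue (f (rep_residue a))"

lemma residue_rep: "residue (rep_residue a) = (a :: 'a residue_field)"
  by (metis Quotient_residue_field Quotient_abs_rep)

lemma fbar_residue: "fbar (residue x) = residue (f x)"
proof -
  have "P dvd rep_residue (residue x) - x" using residue_rep residue_eq by blast
  then show ?thesis unfolding fbar_def residue_eq P_dvd_f_diff_iff .
qed

lemma inj_fbar: "inj fbar"
proof (rule injI)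
  fix a b assume "fbar a = fbar b"
  moreover obtain x y where "a = residue x" "b = residue y" using residue_surj by metis
  ultimately show "a = b"
    using P_dvd_f_diff_iff by (simp add: fbar_residue residue_eq)
qed

lemma surj_fbar: "surj fbar"
  using inj_fbar finite_UNIV_inj_surj[of fbar] by simp

text \<open>How f moves points inside the residue class of x, read one digit beyond the
  residue.\<close>

definition local_map :: "'a \<Rightarrow> 'a \<Rightarrow> 'a residue_field" where
  "local_map x z = res 1 (f (x + P * z) - f x)"

text \<open>A preimage of f x + p u under the bijection f is congruent to x modulo p, because f
  reflects congruence modulo p.\<close>

lemma local_map_surj: "\<exists>z. local_map x z = a"
proof -
  obtain u where u: "a = residue u" using residue_surj by metis
  obtain x' where x': "f x' = f x + P * u" using bij_f by (metis bij_pointE)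
  then have "P dvd x' - x" using P_dvd_f_diff_iff[of x' x] by simp
  then obtain z where "x' - x = P * z" by blast
  then have "x' = x + P * z" by (simp add: algebra_simps)
  then have "f (x + P * z) - f x = P ^ 1 * u" using x' by simp
  then have "local_map x z = a" unfolding local_map_def u by (simp only:) (rule res_eq, use n_ge_2 in simp)
  then show ?thesis ..
qed

text \<open>Put w = y - x and compare y with both x and x + p z: f y - f x = w k and f y - f (x + p
  z) = (w - p z) l. With f (x + p z) - f x = p c, the element k / l of K equals 1 + p (c / (w l) - z
  / w).\<close>

lemma local_map_layer:
  assumes w: "y - x dvd 1"
  shows "local_map x z / residue (f y - f x) - residue z / residue (y - x) \<in> layer 1"
proof -
  obtain k where k: "k \<in> K" "f y - f x = (y - x) * k" using f_diff by blast
  obtain l where l: "l \<in> K" "f y - f (x + P * z) = (y - (x + P * z)) * l" using f_diff by blast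
  obtain j where j: "j \<in> K" "f (x + P * z) - f x = (x + P * z - x) * j" using f_diff by blast
  define c where "c = z * j"
  have c: "f (x + P * z) - f x = P ^ 1 * c" using j by (simp add: c_def mult.assoc)
  have lm: "local_map x z = residue c"
    unfolding local_map_def c using n_ge_2 by (intro res_eq) simp
  obtain l' where l': "l' \<in> K" "l * l' = 1" using unit_subgroup_inverse[OF K l(1)] .
  obtain W where W: "(y - x) * W = 1" using w by (metis dvdE)
  have "(y - x) * k = (f (x + P * z) - f x) + (f y - f (x + P * z))"
    unfolding k(2)[symmetric] by simp
  also have "\<dots> = P ^ 1 * c + (y - (x + P * z)) * l" unfolding c l(2) ..
  finally have eq: "(y - x) * k = P * c + (y - x - P * z) * l" by (simp add: diff_diff_eq)
  have "((y - x) * k) * (W * l') = ((y - x) * W) * (k * l')" by (simp only: mult_ac)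
  then have "k * l' = ((y - x) * k) * (W * l')" by (simp only: W mult_1_left)
  also have "\<dots> = P * c * W * l' + ((y - x) * W - P * z * W) * (l * l')"
    unfolding eq by (simp add: algebra_simps)
  also have "\<dots> = 1 + P ^ 1 * (c * W * l' - z * W)"
    unfolding W l'(2) by (simp add: algebra_simps)
  finally have "1 + P ^ 1 * (c * W * l' - z * W) \<in> K"
    using K k(1) l'(1) unfolding unit_subgroup_def by metis
  then have in_layer: "residue (c * W * l' - z * W) \<in> layer 1"
    unfolding layer_def by (intro CollectI exI[of _ "c * W * l' - z * W"] conjI refl)
      (erule bexI[rotated], simp)
  have nz: "residue (y - x) \<noteq> 0" using w unit_iff by blast
  have W': "residue W = 1 / residue (y - x)"
  proof -
    have "residue (y - x) * residue W = 1" using W by (metis residue_hom(2,6))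
    then show ?thesis using nz by (simp add: eq_divide_eq mult.commute)
  qed
  \<comment> \<open>Modulo p the factors k and l agree, which turns the denominator w l into f y - f
    x.\<close>
  have "residue ((y - x) * k) = residue ((y - x) * l)"
    unfolding residue_eq eq by (simp add: left_diff_distrib mult.assoc)
  then have "residue k = residue l" using nz by (simp add: residue_hom(6))
  moreover have "residue l * residue l' = 1" using l'(2) by (metis residue_hom(2,6))
  ultimately have "residue l' = 1 / residue k"
    by (metis eq_divide_eq mult.commute mult_zero_left zero_neq_one)
  then have "residue (W * l') = 1 / residue (f y - f x)"
    unfolding k(2) residue_hom(6) W' by simp
  then have "residue (c * W * l' - z * W) =
      local_map x z / residue (f y - f x) - residue z / residue (y - x)"
    unfolding residue_hom(4) lm mult.assoc residue_hom(6)[of c] residue_hom(6)[of z] W' by simp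
  then show ?thesis using in_layer by simp
qed

text \<open>The multiples of a nonzero a fill the residue field, while the layer is proper.\<close>

lemma absorb_layer:
  assumes "1 \<le> m" "m < n" "\<And>b. b * a \<in> layer m"
  shows "a = 0"
proof (rule ccontr)
  assume "a \<noteq> 0"
  then have "b \<in> layer m" for b using assms(3)[of "b / a"] by simp
  then show False using layer_proper[OF pure_K assms(1,2)] by blast
qed

text \<open>Let L a be the reciprocal in question. For every z, \<open>local_map x' z * L a\<close>
  equals \<open>residue z * a\<close> up to \<open>layer 1\<close>. The second expression is
  additive in a, so the additive defect of L times any value of \<open>local_map x'\<close> lies in
  \<open>layer 1\<close>; these values are all of F, and \<open>absorb_layer\<close> makes the
  defect zero.\<close>

lemma fbar_inversive:
  "1 / (fbar (x + 1 / (a + b)) - fbar x) = 1 / (fbar (x + 1 / a) - fbar x) + 1 / (fbar (x + 1 / b) - fbar x)"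
proof -
  define L where "L a = 1 / (fbar (x + 1 / a) - fbar x)" for a
  define x' where "x' = rep_residue x"
  have x: "x = residue x'" by (simp add: x'_def residue_rep)
  have L: "local_map x' z * L a - residue z * a \<in> layer 1" for z a
  proof (cases "a = 0")
    \<comment> \<open>Here 1 / 0 = 0 gives \<open>L 0 = 0\<close>, so the expression is 0.\<close>
    case True
    then show ?thesis using layer_closed[of 1] by (simp add: L_def add_closed_def)
  next
    case False
    obtain y where y: "x + 1 / a = residue y" using residue_surj by metis
    then have yx: "residue (y - x') = 1 / a" unfolding residue_hom y[symmetric] x[symmetric] by simp
    then have "y - x' dvd 1" using False unit_iff by simp
    moreover have "residue (f y - f x') = 1 / L a"
      unfolding L_def y residue_hom by (simp add: fbar_residue x)
    ultimately show ?thesis using local_map_layer[of y x' z] yx by simp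
  qed
  have "L (a + b) - (L a + L b) = 0"
  proof (rule absorb_layer[of 1])
    fix c
    obtain z where z: "local_map x' z = c" using local_map_surj by blast
    have "c * (L (a + b) - (L a + L b)) = (c * L (a + b) - residue z * (a + b))
      - (c * L a - residue z * a) - (c * L b - residue z * b)"
      by (simp add: algebra_simps)
    moreover have "\<dots> \<in> layer 1"
      by (intro add_closed_diff[OF layer_closed[of 1]] L[of z, unfolded z]) simp_all
    ultimately show "c * (L (a + b) - (L a + L b)) \<in> layer 1" by metis
  qed (use n_ge_2 in auto)
  then show ?thesis unfolding L_def by simp
qed

lemma fbar_hom: "fbar (a + b) = fbar a + fbar b" "fbar (a * b) = fbar a * fbar b"
proof -
  have 0: "fbar 0 = 0" using fbar_residue[of 0] by (simp add: f_0 residue_hom)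
  have 1: "fbar 1 = 1" using fbar_residue[of 1] by (simp add: f_1 residue_hom)
  show "fbar (a + b) = fbar a + fbar b"
    by (rule inversive_additive_imp_automorphism(1)[OF two_nz inj_fbar 0 1]) (rule fbar_inversive)
  show "fbar (a * b) = fbar a * fbar b"
    by (rule inversive_additive_imp_automorphism(2)[OF two_nz inj_fbar 0 1]) (rule fbar_inversive)
qed

section \<open>Homomorphisms modulo powers of p and linearity of their digits\<close>

definition hom_mod :: "nat \<Rightarrow> bool" where
  "hom_mod m \<longleftrightarrow> (\<forall>x y. P ^ m dvd f (x + y) - f x - f y \<and> P ^ m dvd f (x * y) - f x * f y)"

lemma hom_mod_1: "hom_mod 1"
proof -
  have "residue (f (x + y) - f x - f y) = 0" "residue (f (x * y) - f x * f y) = 0" for x y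
    unfolding residue_hom fbar_residue[symmetric] fbar_hom by simp_all
  then show ?thesis unfolding hom_mod_def residue_0_iff by simp
qed

text \<open>An additive map into a field of characteristic p kills pR, so h factors through s |->
  \<open>residue (f s)\<close>, which is additive and onto. The factor \<open>g\<close> satisfies
  the hypotheses of \<open>additive_quotient_proper\<close>.\<close>

lemma additive_layer_quotient:
  assumes m: "1 \<le> m" "m < n"
    and h: "\<And>x y. h (x + y) = h x + h y"
    and hV: "\<And>s. s dvd 1 \<Longrightarrow> h s / residue (f s) \<in> layer m"
  shows "h s = h 1 * residue (f s)"
proof -
  have hP: "h (P * s) = 0" for s
    using additive_of_nat[of h p s, OF h] CHAR_residue of_nat_CHAR[where 'a="'a residue_field"] by simp
  have cong: "h x = h y" if "residue (f x) = residue (f y)" for x y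
  proof -
    have "P dvd x - y" using that unfolding residue_eq P_dvd_f_diff_iff .
    then obtain z where "x - y = P * z" by blast
    then have "x = y + P * z" by (simp add: algebra_simps)
    then show ?thesis by (simp add: h hP)
  qed
  define pick where "pick a = (SOME x. residue (f x) = a)" for a
  have pick: "residue (f (pick a)) = a" for a
  proof -
    obtain x where "residue (f x) = a" using surj_fbar residue_surj fbar_residue by (metis surj_def)
    then show ?thesis unfolding pick_def by (rule someI)
  qed
  define g where "g a = h (pick a)" for a
  have gh: "g (residue (f x)) = h x" for x
    unfolding g_def by (rule cong) (simp add: pick)
  have "g a = g 1 * a" for a
  proof (rule additive_quotient_proper[of "layer m"])
    show "odd CHAR('a residue_field)" unfolding CHAR_residue by (rule odd_p)
    show "add_closed (layer m)" "layer m \<noteq> UNIV" using layer_closed layer_proper[OF pure_K] m by auto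
    fix a b
    have "g (a + b) = g (residue (f (pick a + pick b)))"
      using hom_mod_1 unfolding hom_mod_def
      by (simp add: fbar_residue[symmetric] residue_hom fbar_hom) (simp add: fbar_residue pick)
    then show "g (a + b) = g a + g b" unfolding gh h by (simp add: g_def)
    assume "a \<noteq> 0"
    then have "pick a dvd 1" using unit_f_iff unit_iff pick by metis
    then show "g a / a \<in> layer m" using hV[of "pick a"] by (simp add: g_def pick)
  qed
  from this[of "residue (f s)"] show ?thesis
    using gh[of 1] by (simp add: gh f_1 residue_hom)
qed

end

section \<open>Lifting from \<open>p ^ m\<close> to \<open>p ^ (m + 1)\<close>\<close>

context normalized_cyclotomic_map
begin

text \<open>Both f (x + s) - f x and f s are s times an element of K, so the first is f s times an
  element of K and \<open>layerI\<close> applies with u = f s.\<close>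

lemma additive_defect_layer:
  assumes m: "m < n" "hom_mod m" and s: "s dvd 1"
  shows "res m (f (x + s) - f x - f s) / residue (f s) \<in> layer m"
proof -
  obtain k where k: "k \<in> K" "f (x + s) - f x = (x + s - x) * k" using f_diff by blast
  obtain j where j: "j \<in> K" "f s - f 0 = (s - 0) * j" using f_diff by blast
  obtain l where l: "l \<in> K" "j * l = 1" using unit_subgroup_inverse[OF K j(1)] .
  have "f s * (l * k) = s * (j * l) * k" using j(2) by (simp add: f_0 mult_ac)
  then have eq: "f s * (l * k) - f s = f (x + s) - f x - f s" using k(2) l(2) by simp
  have "l * k \<in> K" using K k l by (simp add: unit_subgroup_def)
  moreover have "P ^ m dvd f (x + s) - f x - f s" using m(2) unfolding hom_mod_def by blast
  moreover have "f s dvd 1" using s unit_f_iff by blast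
  ultimately show ?thesis using layerI[OF m(1), of "f s" "l * k"] unfolding eq by blast
qed

text \<open>f (r s), f r and f s are r s, r and s times k, i and j in K; hence f (r s) is f r f s
  times k / (i j).\<close>

lemma multiplicative_defect_layer:
  assumes m: "m < n" "hom_mod m" and r: "r dvd 1" and s: "s dvd 1"
  shows "res m (f (r * s) - f r * f s) / residue (f r * f s) \<in> layer m"
proof -
  obtain k where k: "k \<in> K" "f (r * s) - f 0 = (r * s - 0) * k" using f_diff by blast
  obtain i where i: "i \<in> K" "f r - f 0 = (r - 0) * i" using f_diff by blast
  obtain j where j: "j \<in> K" "f s - f 0 = (s - 0) * j" using f_diff by blast
  obtain i' where i': "i' \<in> K" "i * i' = 1" using unit_subgroup_inverse[OF K i(1)] .
  obtain j' where j': "j' \<in> K" "j * j' = 1" using unit_subgroup_inverse[OF K j(1)] .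
  have "(f r * f s) * (k * i' * j') = (r * s * k) * (i * i') * (j * j')"
    using i(2) j(2) by (simp add: f_0 mult_ac)
  also have "\<dots> = f (r * s)" unfolding i' j' using k(2) by (simp add: f_0)
  finally have eq: "(f r * f s) * (k * i' * j') = f (r * s)" .
  have "k * i' * j' \<in> K" using K k i' j' by (simp add: unit_subgroup_def)
  moreover have "f r * f s dvd 1"
    using mult_dvd_mono[of "f r" 1 "f s" 1] unit_f_iff r s by simp
  moreover have "P ^ m dvd f (r * s) - f r * f s" using m(2) unfolding hom_mod_def by blast
  ultimately show ?thesis
    using layerI[OF m(1), of "f r * f s" "k * i' * j'"] unfolding eq by blast
qed

text \<open>The properties of the defect of f that survive differencing. They do so because the
  denominator depends on s alone and a third difference is a difference of two second differences
  with the same s.\<close>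

definition admissible :: "nat \<Rightarrow> ('a \<Rightarrow> 'a) \<Rightarrow> bool" where
  "admissible m F \<longleftrightarrow> (\<forall>s t x. P ^ m dvd differ s (differ t F) x \<and>
     (s dvd 1 \<longrightarrow> res m (differ s (differ t F) x) / residue (f s) \<in> layer m))"

text \<open>Vanishing second differences: additive up to a constant, modulo p^m.\<close>

definition affine_mod :: "nat \<Rightarrow> ('a \<Rightarrow> 'a) \<Rightarrow> bool" where
  "affine_mod m F \<longleftrightarrow> (\<forall>s t x. P ^ m dvd differ s (differ t F) x)"

lemma admissible_diff:
  assumes m: "1 \<le> m" "m < n" and x: "P ^ m dvd x" "res m x / c \<in> layer m"
    and y: "P ^ m dvd y" "res m y / c \<in> layer m"
  shows "res m (x - y) / c \<in> layer m"
  unfolding res_diff[OF m(2) x(1) y(1)] diff_divide_distrib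
  using add_closed_diff[OF layer_closed[OF m(1)] x(2) y(2)] .

lemma admissible_f:
  assumes m: "1 \<le> m" "m < n" "hom_mod m"
  shows "admissible m f"
  unfolding admissible_def
proof (intro allI conjI impI)
  fix s t x
  have eq: "differ s (differ t f) x = (f (x + t + s) - f (x + t) - f s) - (f (x + s) - f x - f s)"
    by (simp add: differ_def algebra_simps)
  have dvd: "P ^ m dvd f (x + s) - f x - f s" for x using m(3) unfolding hom_mod_def by blast
  show "P ^ m dvd differ s (differ t f) x" unfolding eq by (intro dvd_diff dvd)
  assume "s dvd 1"
  then show "res m (differ s (differ t f) x) / residue (f s) \<in> layer m"
    unfolding eq by (intro admissible_diff dvd additive_defect_layer m)
qed

lemma differ_triple: "differ s (differ t (differ u F)) x = differ s (differ t F) (x + u) - differ s (differ t F) x"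
  by (simp add: differ_def algebra_simps)

lemma admissible_differ:
  assumes m: "1 \<le> m" "m < n" and F: "admissible m F"
  shows "admissible m (differ u F)"
  using F unfolding admissible_def differ_triple
  by (auto intro!: admissible_diff[OF m] dvd_diff)

lemma affine_mod_differ: "affine_mod m F \<Longrightarrow> affine_mod m (differ u F)"
  unfolding affine_mod_def differ_triple by (auto intro: dvd_diff)

text \<open>\<open>(E - 1) ^ N = E ^ N - 1\<close> modulo \<open>p\<close> for the translation \<open>E\<close> by \<open>u\<close> and \<open>N = p ^ n\<close>.\<close>
lemma differ_nilpotent:
  fixes G :: "'a \<Rightarrow> 'a"
  assumes "\<And>x. P ^ m dvd G x"
  shows "P ^ Suc m dvd (differ u ^^ (p ^ n)) G x"
proof -
  let ?N = "p ^ n"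
  let ?t = "\<lambda>k. of_nat (?N choose k) * (-1) ^ (?N - k) * G (x + of_nat k * u)"
  have N: "?N > 0" using p_gt_2 by simp
  have "{..?N} = insert 0 (insert ?N {0<..<?N})" using N by auto
  then have "(differ u ^^ ?N) G x = ?t 0 + ?t ?N + (\<Sum>k\<in>{0<..<?N}. ?t k)"
    unfolding differ_funpow_eq using N by (simp add: add.assoc)
  \<comment> \<open>Translation by p^n u is the identity as p^n = 0 in the ring, and (-1)^(p^n) = -1
    as p is odd.\<close>
  also have "?t 0 + ?t ?N = 0" using nilp odd_p by simp
  finally have "(differ u ^^ ?N) G x = (\<Sum>k\<in>{0<..<?N}. ?t k)" by simp
  also have "P ^ Suc m dvd \<dots>"
  proof (rule dvd_sum)
    fix k assume "k \<in> {0<..<?N}"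
    then have "p dvd (?N choose k)" using prime_p by (intro prime_dvd_choose_prime_power) auto
    then have "P dvd of_nat (?N choose k) * (-1) ^ (?N - k)" by (metis dvd_mult2 of_nat_mult dvd_def)
    from mult_dvd_mono[OF this assms] show "P ^ Suc m dvd ?t k" by simp
  qed
  finally show ?thesis .
qed

text \<open>For each new direction u, \<open>differ u\<close> is applied until one more application
  would make the function affine; nilpotency guarantees that this happens. Directions treated
  earlier stay good, since differences commute and preserve \<open>affine_mod\<close>.\<close>

lemma extremal_difference:
  assumes m: "1 \<le> m" "m < n" and "finite S" and F: "admissible m F" "\<not> affine_mod (Suc m) F"
  shows "\<exists>F'. admissible m F' \<and> \<not> affine_mod (Suc m) F' \<and> (\<forall>u\<in>S. affine_mod (Suc m) (differ u F'))"
  using assms(3)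
proof (induction S rule: finite_induct)
  case empty
  then show ?case using F by blast
next
  case (insert u S)
  then obtain F' where F': "admissible m F'" "\<not> affine_mod (Suc m) F'"
    "\<And>v. v \<in> S \<Longrightarrow> affine_mod (Suc m) (differ v F')" by blast
  let ?A = "\<lambda>i. affine_mod (Suc m) ((differ u ^^ i) F')"
  have "P ^ Suc m dvd differ s (differ t ((differ u ^^ (p ^ n)) F')) x" for s t x
    unfolding differ_funpow_commute[symmetric]
    by (rule differ_nilpotent) (use F'(1) in \<open>simp add: admissible_def\<close>)
  then have ex: "?A (p ^ n)" unfolding affine_mod_def by blast
  define i where "i = (LEAST i. ?A i)"
  have Ai: "?A i" unfolding i_def by (rule LeastI[of ?A, OF ex])
  have "i \<noteq> 0" using Ai F'(2) by (cases i) auto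
  then obtain j where j: "i = Suc j" by (cases i) auto
  define F'' where "F'' = (differ u ^^ j) F'"
  have "\<not> affine_mod (Suc m) F''" unfolding F''_def using not_less_Least[of j ?A] j i_def by simp
  moreover have "admissible m F''"
    unfolding F''_def using F'(1) by (induction j) (auto intro!: admissible_differ[OF m])
  moreover have "affine_mod (Suc m) (differ u F'')" using Ai unfolding j F''_def by simp
  moreover have "affine_mod (Suc m) (differ v F'')" if "v \<in> S" for v
  proof -
    have "affine_mod (Suc m) ((differ u ^^ j) (differ v F'))" for j
      using F'(3)[OF that] by (induction j) (simp_all add: affine_mod_differ)
    then show ?thesis unfolding F''_def differ_funpow_commute .
  qed
  ultimately show ?case by blast
qed

text \<open>If \<open>f\<close> were not additive modulo \<open>p ^ (m + 1)\<close>, an iterated difference of \<open>f\<close> would have a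
  constant nonzero second difference \<open>b\<close>. It is symmetric and biadditive, hence by the finite-field
  lemma a multiple of \<open>f s * f t\<close>, and the multiples of the residue of \<open>f t\<close> exhaust the residue field.\<close>
lemma affine_mod_step:
  assumes m: "1 \<le> m" "m < n" "hom_mod m"
  shows "affine_mod (Suc m) f"
proof (rule ccontr)
  assume "\<not> affine_mod (Suc m) f"
  then obtain F where F: "admissible m F" "\<not> affine_mod (Suc m) F"
    and third: "\<And>u. affine_mod (Suc m) (differ u F)"
    using extremal_difference[OF m(1,2) finite admissible_f[OF m], of UNIV] by blast
  define b where "b s t = res m (differ s (differ t F) 0)" for s t
  have dvd: "P ^ m dvd differ s (differ t F) x" for s t x using F(1) unfolding admissible_def by blast
  have const: "res m (differ s (differ t F) x) = b s t" for s t x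
    unfolding b_def
  proof (rule res_cong[OF m(2) dvd])
    show "P ^ Suc m dvd differ s (differ t F) x - differ s (differ t F) 0"
      using third[of x] differ_triple[of s t x F 0] unfolding affine_mod_def by simp metis
  qed
  have sym: "b s t = b t s" for s t unfolding b_def by (subst differ_commute) (rule refl)
  have add: "b (s + s') t = b s t + b s' t" for s s' t
  proof -
    \<comment> \<open>This identity holds for every function; it becomes additivity of
      \<open>b\<close> because \<open>const\<close> removes the base point
      \<open>s'\<close>.\<close>
    have "differ (s + s') (differ t F) 0 = differ s (differ t F) s' + differ s' (differ t F) 0"
      by (simp add: differ_def[of _ "differ t F"] add.commute)
    then show ?thesis unfolding b_def[of "s + s'"] by (simp add: res_add[OF m(2)] dvd const)
  qed
  have in_layer: "b s t / residue (f s) \<in> layer m" if "s dvd 1" for s t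
    using F(1) that unfolding admissible_def b_def by blast
  have b1: "b s t = b 1 t * residue (f s)" for s t
    by (rule additive_layer_quotient[OF m(1,2), of "\<lambda>s. b s t"]) (rule add, rule in_layer)
  have b11: "b 1 t = b 1 1 * residue (f t)" for t
    unfolding sym[of 1 t] by (rule b1)
  have "c * b 1 1 \<in> layer m" for c
  proof -
    obtain a where "fbar a = c" using surj_fbar by (metis surj_def)
    then obtain t where "c = residue (f t)" using residue_surj fbar_residue by metis
    then show ?thesis using in_layer[of 1 t] b11[of t] by (simp add: f_1 residue_hom mult.commute)
  qed
  then have "b 1 1 = 0" by (rule absorb_layer[OF m(1,2)])
  then have "b s t = 0" for s t using b1[of s t] b11[of t] by simp
  then have "P ^ Suc m dvd differ s (differ t F) x" for s t x
    using res_0_iff[OF m(2) dvd] const by metis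
  then show False using F(2) unfolding affine_mod_def by blast
qed

text \<open>Additivity has to come first: it makes the multiplicative defect with a fixed unit r
  additive in s, so linearity applies without any differencing, and the defect vanishes at s = 1
  because f 1 = 1.\<close>

lemma hom_mod_Suc:
  assumes m: "1 \<le> m" "m < n" "hom_mod m"
  shows "hom_mod (Suc m)"
proof -
  have add: "P ^ Suc m dvd f (x + y) - f x - f y" for x y
  proof -
    have "differ x (differ y f) 0 = f (x + y) - f x - f y"
      by (simp add: differ_def f_0 algebra_simps)
    then show ?thesis using affine_mod_step[OF m] unfolding affine_mod_def by metis
  qed
  have unit: "P ^ Suc m dvd f (r * s) - f r * f s" if r: "r dvd 1" for r s
  proof -
    have dvd: "P ^ m dvd f (r * s) - f r * f s" for s using m(3) unfolding hom_mod_def by blast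
    have r0: "residue (f r) \<noteq> 0" using r unit_f_iff unit_iff by blast
    define h where "h s = res m (f (r * s) - f r * f s) / residue (f r)" for s
    have "h s = h 1 * residue (f s)" for s
    proof (rule additive_layer_quotient[OF m(1,2), of h])
      fix s t
      \<comment> \<open>The failure of the defect to be additive is a combination of additive
        defects of f, already zero modulo p^(m+1).\<close>
      have "f (r * (s + t)) - f r * f (s + t) - ((f (r * s) - f r * f s) + (f (r * t) - f r * f t))
        = (f (r * s + r * t) - f (r * s) - f (r * t)) - f r * (f (s + t) - f s - f t)"
        by (simp add: algebra_simps)
      also have "P ^ Suc m dvd \<dots>" by (intro dvd_diff dvd_mult add)
      finally have "res m (f (r * (s + t)) - f r * f (s + t)) =
          res m ((f (r * s) - f r * f s) + (f (r * t) - f r * f t))"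
        by (rule res_cong[OF m(2) dvd])
      then show "h (s + t) = h s + h t"
        unfolding h_def by (simp add: res_add[OF m(2) dvd dvd] add_divide_distrib)
    next
      fix s :: 'a assume "s dvd 1"
      then show "h s / residue (f s) \<in> layer m"
        using multiplicative_defect_layer[OF m(2,3) r, of s] by (simp add: h_def residue_hom(6))
    qed
    moreover have "h 1 = 0" unfolding h_def using res_0_iff[OF m(2), of 0] by (simp add: f_1)
    ultimately have "res m (f (r * s) - f r * f s) = 0"
      using r0 unfolding h_def by (metis divide_eq_0_iff mult_zero_left)
    then show ?thesis using res_0_iff[OF m(2) dvd] by blast
  qed
  have "P ^ Suc m dvd f (r * s) - f r * f s" for r s
  proof (cases "r dvd 1")
    case False
    \<comment> \<open>A nonunit r is reached from the unit r + 1 by distributivity.\<close>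
    then have "residue (r + 1) = 1" unfolding unit_iff by (simp add: residue_hom)
    then have "r + 1 dvd 1" unfolding unit_iff by simp
    have "f (r * s) - f r * f s = (f ((r + 1) * s) - f (r + 1) * f s)
      - (f (r * s + s) - f (r * s) - f s) + (f (r + 1) - f r - f 1) * f s"
      by (simp add: f_1 algebra_simps)
    also have "P ^ Suc m dvd \<dots>"
      by (intro dvd_add dvd_diff dvd_mult2 add unit \<open>r + 1 dvd 1\<close>)
    finally show ?thesis .
  qed (rule unit)
  then show ?thesis unfolding hom_mod_def using add by blast
qed

lemma ring_aut_f: "ring_aut f"
proof -
  have "hom_mod m" if "1 \<le> m" "m \<le> n" for m
    using that by (induction m rule: dec_induct) (use hom_mod_1 hom_mod_Suc in auto)
  then have "hom_mod n" using n_ge_2 by simp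
  then have "f (x + y) = f x + f y" "f (x * y) = f x * f y" for x y
    unfolding hom_mod_def nilp by (auto simp: algebra_simps)
  then show ?thesis unfolding ring_aut_def using bij_f f_1 by blast
qed

end

section \<open>Normality and purity\<close>

text \<open>Forwards, the relation for r = y - x contains (x, y) because 1 is in K. Backwards, f
  maps each relation into itself because K is closed under products, and an injective self-map of a
  finite set is onto.\<close>

lemma cyc_aut_iff:
  fixes K :: "'a::{comm_ring_1,finite} set"
  assumes K: "unit_subgroup K"
  shows "f \<in> cyc_aut K \<longleftrightarrow> bij f \<and> (\<forall>x y. \<exists>k\<in>K. f y - f x = (y - x) * k)"
proof (intro iffI conjI allI)
  assume f: "f \<in> cyc_aut K"
  then show "bij f" by (simp add: cyc_aut_def)
  fix x y
  let ?S = "{(u, v). v - u \<in> (\<lambda>k. (y - x) * k) ` K}"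
  have "?S \<in> cyc_rel K" unfolding cyc_rel_def by blast
  then have eq: "(\<lambda>(x, y). (f x, f y)) ` ?S = ?S"
    using f unfolding cyc_aut_def mem_Collect_eq by (elim conjE bspec)
  have "1 \<in> K" using K by (simp add: unit_subgroup_def)
  then have "(x, y) \<in> ?S" by (auto intro: image_eqI[of _ _ 1])
  then have "(f x, f y) \<in> (\<lambda>(x, y). (f x, f y)) ` ?S" by (rule image_eqI[rotated]) simp
  then show "\<exists>k\<in>K. f y - f x = (y - x) * k" unfolding eq by auto
next
  assume asm: "bij f \<and> (\<forall>x y. \<exists>k\<in>K. f y - f x = (y - x) * k)"
  have "(\<lambda>(x, y). (f x, f y)) ` S = S" if S_rel: "S \<in> cyc_rel K" for S
  proof -
    obtain r where S: "S = {(x, y). y - x \<in> (\<lambda>k. r * k) ` K}"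
      using S_rel unfolding cyc_rel_def mem_Collect_eq by (elim exE conjE) rule
    have "(f x, f y) \<in> S" if xy: "(x, y) \<in> S" for x y
    proof -
      obtain k where k: "k \<in> K" "y - x = r * k" using xy unfolding S by auto
      obtain l where l: "l \<in> K" "f y - f x = (y - x) * l" using asm by blast
      have "k * l \<in> K" using K k l by (simp add: unit_subgroup_def)
      moreover have "f y - f x = r * (k * l)" unfolding l(2) k(2) by (rule mult.assoc)
      ultimately show ?thesis unfolding S by blast
    qed
    then have "(\<lambda>(x, y). (f x, f y)) ` S \<subseteq> S" by (intro image_subsetI) (simp add: split_beta)
    moreover have "inj_on (\<lambda>(x, y). (f x, f y)) S"
      using asm by (auto intro!: inj_onI simp: bij_def inj_eq)
    ultimately show ?thesis by (intro endo_inj_surj) simp_all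
  qed
  then show "f \<in> cyc_aut K"
    unfolding cyc_aut_def mem_Collect_eq using asm by (intro conjI ballI) (rule conjunct1)
qed

text \<open>Nilpotency of p comes from finiteness and locality; n is at least 2 because pR = 0 would
  make the ring a field.\<close>

lemma galois_setting_exists:
  assumes "galois_ring TYPE('a::{comm_ring_1,finite})" "odd CHAR('a)" "\<not> is_field_ring TYPE('a)"
  obtains p n :: nat where "prime p" "odd p" "n \<ge> 2" "max_ideal TYPE('a) = {of_nat p * r | r. True}"
    "of_nat p ^ n = (0 :: 'a)" "of_nat p ^ (n - 1) \<noteq> (0 :: 'a)"
proof -
  obtain p :: nat where p: "prime p" "rad TYPE('a) = {of_nat p * r | r::'a. True}"
    using assms(1) unfolding galois_ring_def by blast
  have M: "max_ideal TYPE('a) = {of_nat p * r | r. True}"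
  proof -
    have "\<exists>!M::'a set. maximal_ideal M" using assms(1) unfolding galois_ring_def local_ring_def by blast
    then have "rad TYPE('a) = max_ideal TYPE('a)"
      unfolding rad_def using maximal_max_ideal by (metis the1_equality)
    then show ?thesis using p by simp
  qed
  have PM: "(of_nat p :: 'a) \<in> max_ideal TYPE('a)" unfolding M by (metis (mono_tags) mem_Collect_eq mult.right_neutral)
  have inv: "\<exists>y. x * y = 1" if x: "residue x \<noteq> 0" and k: "of_nat p ^ k = (0 :: 'a)" for x :: 'a and k
  proof -
    obtain y r where "x * y - 1 = of_nat p * r"
      using inverse_mod_max_ideal[of x] x unfolding residue_eq_0_iff M by blast
    then have "x * y = 1 - of_nat p * (- r)" by (simp add: algebra_simps)
    moreover have "(of_nat p * (- r)) ^ k = 0" unfolding power_mult_distrib k by simp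
    then have "1 = (1 - of_nat p * (- r)) * (\<Sum>i<k. (of_nat p * (- r)) ^ i)"
      unfolding one_diff_power_eq[symmetric] by simp
    ultimately show ?thesis by (metis mult.assoc)
  qed
  \<comment> \<open>Pigeonhole on the powers of p gives p^i (1 - p^(j-i)) = 0, and the second factor
    will be a unit.\<close>
  obtain i j where ij: "i < j" "(of_nat p :: 'a) ^ i = of_nat p ^ j"
  proof -
    have "\<not> inj (\<lambda>i. (of_nat p :: 'a) ^ i)"
      using finite_imageD[of "\<lambda>i. (of_nat p :: 'a) ^ i" UNIV] by auto
    then show ?thesis using that unfolding inj_def by (metis linorder_neqE_nat)
  qed
  have nil: "\<exists>k. (of_nat p :: 'a) ^ k = 0"
  proof -
    let ?z = "(of_nat p :: 'a) ^ (j - i)"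
    have "?z \<in> max_ideal TYPE('a)" using max_ideal_simps(4)[OF PM] ij(1) by (cases "j - i") auto
    then have z: "residue ?z = 0" by (simp add: residue_eq_0_iff)
    have "of_nat p ^ i * ?z = (of_nat p :: 'a) ^ j" using ij(1) by (simp flip: power_add)
    then have "of_nat p ^ i * (1 - ?z) = 0" using ij(2) by (simp add: right_diff_distrib)
    \<comment> \<open>A nonunit lies in some maximal ideal, which is pR by locality; it also
      contains \<open>?z\<close>, hence would contain 1.\<close>
    have "1 - ?z dvd 1"
    proof (rule ccontr)
      assume "\<not> 1 - ?z dvd 1"
      then have "1 \<notin> {(1 - ?z) * r | r. True}" by (auto simp: dvd_def)
      then obtain N where N: "maximal_ideal N" "{(1 - ?z) * r | r. True} \<subseteq> N"
        using exists_maximal_ideal[OF is_ideal_principal] by metis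
      have "N = max_ideal TYPE('a)"
        using N(1) maximal_max_ideal assms(1) unfolding galois_ring_def local_ring_def by blast
      then have "(1 - ?z) * 1 \<in> max_ideal TYPE('a)" using N(2) by blast
      then show False using z by (simp add: residue_eq_0_iff[symmetric] residue_hom)
    qed
    then obtain v where "1 = (1 - ?z) * v" by blast
    then have "(of_nat p :: 'a) ^ i = of_nat p ^ i * (1 - ?z) * v" by (simp add: mult.assoc)
    then show ?thesis using \<open>of_nat p ^ i * (1 - ?z) = 0\<close> by auto
  qed
  define n where "n = (LEAST k. (of_nat p :: 'a) ^ k = 0)"
  have n: "(of_nat p :: 'a) ^ n = 0" unfolding n_def by (rule LeastI_ex[OF nil])
  have less: "(of_nat p :: 'a) ^ k \<noteq> 0" if "k < n" for k using that not_less_Least unfolding n_def by blast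
  have "n \<noteq> 0" using n by (cases n) auto
  moreover have "n \<noteq> 1"
  proof
    assume "n = 1"
    then have "(of_nat p :: 'a) = 0" using n by simp
    then have "max_ideal TYPE('a) = {0}" unfolding M by auto
    then have "is_field_ring TYPE('a)"
      unfolding is_field_ring_def using inv[OF _ n] residue_eq_0_iff by (metis dvd_def singletonD zero_neq_one)
    then show False using assms(3) by blast
  qed
  moreover have "odd p"
  proof
    assume "even p"
    \<comment> \<open>Then the characteristic divides 2^n and is odd, so it is 1.\<close>
    then have "p = 2" using p(1) by (metis prime_nat_iff dvd_def two_is_prime_nat primes_dvd_imp_eq)
    then have "CHAR('a) dvd 2 ^ n" using n by (simp flip: of_nat_eq_0_iff_char_dvd)
    then obtain i where "CHAR('a) = 2 ^ i" using divides_primepow_nat[OF two_is_prime_nat] by blast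
    then have "CHAR('a) = 1" using assms(2) by (cases i) auto
    then have "(of_nat 1 :: 'a) = 0" by (metis of_nat_CHAR)
    then show False by simp
  qed
  ultimately show ?thesis using that[OF p(1) _ _ M n] less[of "n - 1"] by simp
qed


lemma (in galois_setting) normal_imp_pure:
  assumes "cyc_normal K"
  shows "pure K"
  unfolding pure_def
proof (intro allI impI)
  fix I :: "'a set"
  assume "is_ideal I \<and> {k + i | k i. k \<in> K \<and> i \<in> I} = K"
  then have I: "is_ideal I" and KI: "\<And>k i. k \<in> K \<Longrightarrow> i \<in> I \<Longrightarrow> k + i \<in> K" by blast+
  have one: "1 \<in> K" using K by (simp add: unit_subgroup_def)
  have mult_I: "x * i \<in> I" if "i \<in> I" for x i using I that by (simp add: is_ideal_def)
  let ?M = "max_ideal TYPE('a)"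
  have "a = 0" if a: "a \<in> I" for a
  proof -
    \<comment> \<open>If a were a unit, -1 would be in I and 0 = 1 + (-1) would be in K.\<close>
    have aM: "a \<in> ?M"
    proof (rule ccontr)
      assume "a \<notin> ?M"
      then obtain v where "1 = a * v" using unit_iff[of a] residue_eq_0_iff[of a] by (auto elim: dvdE)
      then have "- 1 \<in> I" using mult_I[OF a, of "- v"] by (simp add: mult.commute)
      from KI[OF one this] have "(0 :: 'a) \<in> K" by simp
      then have "(0 :: 'a) dvd 1" using K_unit[of 0] by simp
      then show False by simp
    qed
    have shift: "x + a \<in> ?M \<longleftrightarrow> x \<in> ?M" "x - a \<in> ?M \<longleftrightarrow> x \<in> ?M" for x
      using aM by (simp_all add: residue_eq_0_iff[symmetric] residue_hom)
    define f where "f x = (if x \<in> ?M then x + a else x)" for x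
    have "f \<in> cyc_aut K"
      unfolding cyc_aut_iff[OF K]
    proof (intro conjI allI)
      show "bij f"
        by (rule bij_betw_byWitness[of _ "\<lambda>x. if x \<in> ?M then x - a else x"]) (auto simp: f_def shift)
      fix x y
      \<comment> \<open>A change of a unit difference by i in I is multiplication by 1 + i / (y -
        x), an element of 1 + I and so of K.\<close>
      have perturb: "\<exists>k\<in>K. y - x + i = (y - x) * k" if yx: "y - x \<notin> ?M" and i: "i \<in> I" for i
      proof -
        obtain v where v: "(y - x) * v = 1" using yx unit_iff[of "y - x"] residue_eq_0_iff[of "y - x"] by (metis dvdE)
        have "y - x + i = (y - x) + ((y - x) * v) * i" using v by simp
        then have "y - x + i = (y - x) * (1 + v * i)" by (simp add: distrib_left mult.assoc)
        moreover have "1 + v * i \<in> K" using KI[OF one] mult_I[OF i] by blast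
        ultimately show ?thesis by blast
      qed
      show "\<exists>k\<in>K. f y - f x = (y - x) * k"
      proof (cases "(x \<in> ?M) = (y \<in> ?M)")
        case True
        then show ?thesis using one by (intro bexI[of _ 1]) (auto simp: f_def)
      next
        case False
        then have nM: "y - x \<notin> ?M" by (auto simp: residue_eq_0_iff[symmetric] residue_hom)
        have "- a \<in> I" using mult_I[OF a, of "- 1"] by simp
        then show ?thesis using perturb[OF nM a] perturb[OF nM, of "- a"] False
          by (auto simp: f_def algebra_simps)
      qed
    qed
    then obtain u b \<sigma> where \<sigma>: "ring_aut \<sigma>" "f = (\<lambda>x. u * \<sigma> x + b)"
      using assms unfolding cyc_normal_def AGammaL1_def by blast
    have \<sigma>_add: "\<sigma> (x + y) = \<sigma> x + \<sigma> y" for x y using \<sigma>(1) by (simp add: ring_aut_def)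
    have s0: "\<sigma> 0 = 0" using \<sigma>_add[of 0 0] by simp
    have s1: "\<sigma> 1 = 1" using \<sigma>(1) by (simp add: ring_aut_def)
    have "\<sigma> 1 + \<sigma> (- 1) = 0" unfolding \<sigma>_add[symmetric] by (simp add: s0)
    then have sm: "\<sigma> (- 1) = - 1" by (simp add: s1 eq_neg_iff_add_eq_0 add.commute)
    have nM: "(1 :: 'a) \<notin> ?M" "- 1 \<notin> ?M"
      by (simp_all add: residue_eq_0_iff[symmetric] residue_hom)
    \<comment> \<open>f moves 0 to a and fixes the units 1 and -1; the affine form at these three
      points gives 2 a = 0.\<close>
    have "b = a" using fun_cong[OF \<sigma>(2), of 0] by (simp add: f_def s0 max_ideal_simps)
    moreover have "u + b = 1" using fun_cong[OF \<sigma>(2), of 1] nM by (simp add: f_def s1)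
    moreover have "- u + b = - 1" using fun_cong[OF \<sigma>(2), of "- 1"] nM by (simp add: f_def sm)
    moreover have "(u + b) + (- u + b) = 2 * b" by simp
    ultimately have "2 * a = 0" by simp
    moreover have "residue (2 :: 'a) = 2" using residue_of_nat[of 2] by simp
    then have "(2 :: 'a) dvd 1" unfolding unit_iff using two_nz by simp
    then obtain v :: 'a where "1 = 2 * v" by blast
    then have "a = v * (2 * a)" by (metis mult.assoc mult.commute mult_1_left)
    ultimately show "a = 0" by simp
  qed
  then show "I = {0}" using I unfolding is_ideal_def by blast
qed

lemma (in galois_setting) pure_imp_normal:
  assumes "n \<ge> 2" "pure K"
  shows "cyc_normal K"
  unfolding cyc_normal_def
proof
  fix f assume "f \<in> cyc_aut K"
  then have bij: "bij f" and f: "\<And>x y. \<exists>k\<in>K. f y - f x = (y - x) * k"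
    unfolding cyc_aut_iff[OF K] by blast+
  \<comment> \<open>Since k = f 1 - f 0 lies in K, subtracting f 0 and dividing by k keeps the
    difference condition and achieves g 0 = 0 and g 1 = 1.\<close>
  define k where "k = f 1 - f 0"
  have "k \<in> K" using f[of 1 0] by (auto simp: k_def)
  then obtain l where l: "l \<in> K" "k * l = 1" using unit_subgroup_inverse[OF K] by blast
  define g where "g x = l * (f x - f 0)" for x
  have fg: "f x = k * g x + f 0" for x
  proof -
    have "k * g x = (k * l) * (f x - f 0)" by (simp only: g_def mult.assoc)
    then show ?thesis by (simp add: l)
  qed
  have "normalized_cyclotomic_map p n K g"
  proof unfold_locales
    show "bij g"
      using finite_UNIV_inj_surj[of g] bij fg by (metis bijI bij_def finite inj_def)
    show "g 0 = 0" by (simp add: g_def)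
    show "g 1 = 1" using l(2) by (simp add: g_def k_def mult.commute)
    fix x y
    obtain j where j: "j \<in> K" "f y - f x = (y - x) * j" using f by blast
    have "g y - g x = l * (f y - f x)" by (simp add: g_def algebra_simps)
    also have "\<dots> = (y - x) * (l * j)" by (simp add: j mult_ac)
    finally show "\<exists>k\<in>K. g y - g x = (y - x) * k" using K j l by (auto simp: unit_subgroup_def)
  qed (use assms in auto)
  then have "ring_aut g" by (rule normalized_cyclotomic_map.ring_aut_f)
  moreover have "f = (\<lambda>x. k * g x + f 0)" using fg by blast
  moreover have "k dvd 1" using l(2) by (metis dvdI)
  ultimately show "f \<in> AGammaL1" unfolding AGammaL1_def by blast
qed

theorem theorem1p6:
  fixes K :: "'a::{comm_ring_1,finite} set"
  assumes "galois_ring TYPE('a)"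
    and "odd CHAR('a)"
    and "\<not> is_field_ring TYPE('a)"
    and "unit_subgroup K"
  shows "cyc_normal K \<longleftrightarrow> pure K"
proof -
  obtain p n :: nat where *: "prime p" "odd p" "n \<ge> 2" "max_ideal TYPE('a) = {of_nat p * r | r. True}"
    "of_nat p ^ n = (0 :: 'a)" "of_nat p ^ (n - 1) \<noteq> (0 :: 'a)"
    using galois_setting_exists[OF assms(1-3)] .
  then interpret galois_setting p n K by unfold_locales (use assms(4) in auto)
  show ?thesis using normal_imp_pure pure_imp_normal[OF *(3)] by blast
qed

end
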